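(* Let $T$ and $P$ be as in the context, and let $\lambda\in\mathrm{res}^*(P)$ and $n\ge1$. Every $\lambda$-polyharmonic function $f:T\to\mathbb{C}$ of order $n$ has an integral representation $$f(x)=\sum_{r=0}^{n-1}\int_{\partial T}K^{(r)}(x,\xi\mid\lambda)\,d\nu_r(\xi),\qquad x\in T,$$ where the complex distributions $\nu_0,\dots,\nu_{n-1}$ are uniquely determined by $f$. Conversely, every function having such a representation is $\lambda$-polyharmonic of order $n$.
   Context: $T$ is a countable tree without leaves; degrees may be countably infinite. $P$ is stochastic with $p(x,y)>0$ iff $x\sim y$, and $Pf(x)=\sum_y p(x,y)f(y)$ (absolutely convergent). A function $f$ is $\lambda$-polyharmonic of order $n$ if $(\lambda I-P)^nf=0$, where all successive applications of $P$ are defined by absolutely convergent sums. Fix a root $o$, and let $\mathsf m(x)=\prod_{i=1}^k p(x_{i-1},x_i)/p(x_i,x_{i-1})$ along $\pi(o,x)=[x_0,\dots,x_k]$. $P$ is a bounded self-adjoint operator on $\ell^2(T,\mathsf m)$, and $\mathrm{res}(P)=\mathbb{C}\setminus\mathrm{spec}(P)$. For $\lambda\in\mathrm{res}(P)$, $G(x,y\mid\lambda)=((\lambda I-P)^{-1}\mathbf 1_y)(x)$. $\mathrm{res}^*(P)=\{\lambda\in\mathrm{res}(P):G(x,x\mid\lambda)\ne0\ \forall x\}$. $\partial T$ is the set of ends. $x\wedge w$ is the last common vertex of $\pi(o,x)$ and $\pi(o,w)$. $K(x,\xi\mid\lambda)=G(x,x\wedge\xi\mid\lambda)/G(o,x\wedge\xi\mid\lambda)$,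 and $K^{(r)}$ is its $r$-th derivative in $\lambda$. $x^-$ is the neighbour of $x\neq o$ closer to $o$. $\partial T_x$ is the set of ends whose ray from $o$ passes through $x$. A complex distribution is $\nu:\{\partial T_x\}\to\mathbb{C}$ with $\nu(\partial T_x)=\sum_{y^-=x}\nu(\partial T_y)$, absolutely convergent. Integral of a locally constant $\varphi$ (constant value $\varphi_x$ on $\partial T_x\setminus\bigcup_{y\in\tau,y^-=x}\partial T_y$ for each $x$ in a finite subtree $\tau\ni o$): $\int\varphi\,d\nu=\sum_{x\in\tau}\varphi_x(\nu(\partial T_x)-\sum_{y\in\tau,y^-=x}\nu(\partial T_y))$. For fixed $x$, $\xi\mapsto K^{(r)}(x,\xi\mid\lambda)$ is locally constant, with $\tau=\pi(o,x)$. *)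

theory Defs
  imports "HOL-Analysis.Analysis"
begin

definition is_walk :: "('v \<Rightarrow> 'v \<Rightarrow> bool) \<Rightarrow> 'v list \<Rightarrow> bool" where
  "is_walk adj xs \<longleftrightarrow> xs \<noteq> [] \<and> (\<forall>i. Suc i < length xs \<longrightarrow> adj (xs ! i) (xs ! Suc i))"

definition is_simple_path :: "('v \<Rightarrow> 'v \<Rightarrow> bool) \<Rightarrow> 'v \<Rightarrow> 'v \<Rightarrow> 'v list \<Rightarrow> bool" where
  "is_simple_path adj x y xs \<longleftrightarrow> is_walk adj xs \<and> distinct xs \<and> hd xs = x \<and> last xs = y"

definition is_tree :: "('v \<Rightarrow> 'v \<Rightarrow> bool) \<Rightarrow> bool" where
  "is_tree adj \<longleftrightarrow> (\<forall>x y. adj x y \<longrightarrow> adj y x) \<and> (\<forall>x. \<not> adj x x) \<and>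
     (\<forall>x y. \<exists>!xs. is_simple_path adj x y xs)"

definition no_leaves :: "('v \<Rightarrow> 'v \<Rightarrow> bool) \<Rightarrow> bool" where
  "no_leaves adj \<longleftrightarrow> (\<forall>x. \<exists>y z. adj x y \<and> adj x z \<and> y \<noteq> z)"

definition geod :: "('v \<Rightarrow> 'v \<Rightarrow> bool) \<Rightarrow> 'v \<Rightarrow> 'v \<Rightarrow> 'v list" where
  "geod adj rt x = (THE xs. is_simple_path adj rt x xs)"

definition parent :: "('v \<Rightarrow> 'v \<Rightarrow> bool) \<Rightarrow> 'v \<Rightarrow> 'v \<Rightarrow> 'v" where
  "parent adj rt x = (THE y. adj y x \<and> y \<in> set (geod adj rt x))"

definition children :: "('v \<Rightarrow> 'v \<Rightarrow> bool) \<Rightarrow> 'v \<Rightarrow> 'v \<Rightarrow> 'v set" where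
  "children adj rt x = {y. y \<noteq> rt \<and> parent adj rt y = x}"

text \<open>Ends are represented by the geodesic rays starting at the root \<open>rt\<close>.\<close>
definition ends :: "('v \<Rightarrow> 'v \<Rightarrow> bool) \<Rightarrow> 'v \<Rightarrow> (nat \<Rightarrow> 'v) set" where
  "ends adj rt = {\<xi>. \<xi> 0 = rt \<and> (\<forall>n. adj (\<xi> n) (\<xi> (Suc n))) \<and> inj \<xi>}"

definition bdy :: "('v \<Rightarrow> 'v \<Rightarrow> bool) \<Rightarrow> 'v \<Rightarrow> 'v \<Rightarrow> (nat \<Rightarrow> 'v) set" where
  "bdy adj rt x = {\<xi> \<in> ends adj rt. \<exists>n. \<xi> n = x}"

definition confl :: "('v \<Rightarrow> 'v \<Rightarrow> bool) \<Rightarrow> 'v \<Rightarrow> 'v \<Rightarrow> (nat \<Rightarrow> 'v) \<Rightarrow> 'v" where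
  "confl adj rt x \<xi> = \<xi> (GREATEST k. \<xi> k \<in> set (geod adj rt x))"

definition stochastic :: "('v \<Rightarrow> 'v \<Rightarrow> bool) \<Rightarrow> ('v \<Rightarrow> 'v \<Rightarrow> real) \<Rightarrow> bool" where
  "stochastic adj p \<longleftrightarrow> (\<forall>x y. p x y \<ge> 0) \<and> (\<forall>x y. p x y > 0 \<longleftrightarrow> adj x y) \<and>
     (\<forall>x. (p x has_sum 1) UNIV)"

definition Pop :: "('v \<Rightarrow> 'v \<Rightarrow> real) \<Rightarrow> ('v \<Rightarrow> complex) \<Rightarrow> 'v \<Rightarrow> complex" where
  "Pop p f x = (\<Sum>\<^sub>\<infinity>y. complex_of_real (p x y) * f y)"

definition Pdefined :: "('v \<Rightarrow> 'v \<Rightarrow> real) \<Rightarrow> ('v \<Rightarrow> complex) \<Rightarrow> bool" where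
  "Pdefined p f \<longleftrightarrow> (\<forall>x. (\<lambda>y. norm (complex_of_real (p x y) * f y)) summable_on UNIV)"

definition Lop :: "('v \<Rightarrow> 'v \<Rightarrow> real) \<Rightarrow> complex \<Rightarrow> ('v \<Rightarrow> complex) \<Rightarrow> 'v \<Rightarrow> complex" where
  "Lop p lam f x = lam * f x - Pop p f x"

definition polyharmonic :: "('v \<Rightarrow> 'v \<Rightarrow> real) \<Rightarrow> complex \<Rightarrow> nat \<Rightarrow> ('v \<Rightarrow> complex) \<Rightarrow> bool" where
  "polyharmonic p lam n f \<longleftrightarrow> (\<forall>k<n. Pdefined p ((Lop p lam ^^ k) f)) \<and> (Lop p lam ^^ n) f = (\<lambda>_. 0)"

definition mfun :: "('v \<Rightarrow> 'v \<Rightarrow> bool) \<Rightarrow> ('v \<Rightarrow> 'v \<Rightarrow> real) \<Rightarrow> 'v \<Rightarrow> 'v \<Rightarrow> real" where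
  "mfun adj p rt x = (let xs = geod adj rt x in
      prod_list (map (\<lambda>(a, b). p a b / p b a) (zip xs (tl xs))))"

definition l2m :: "('v \<Rightarrow> 'v \<Rightarrow> bool) \<Rightarrow> ('v \<Rightarrow> 'v \<Rightarrow> real) \<Rightarrow> 'v \<Rightarrow> ('v \<Rightarrow> complex) set" where
  "l2m adj p rt = {f. (\<lambda>x. (cmod (f x))\<^sup>2 * mfun adj p rt x) summable_on UNIV}"

definition resP :: "('v \<Rightarrow> 'v \<Rightarrow> bool) \<Rightarrow> ('v \<Rightarrow> 'v \<Rightarrow> real) \<Rightarrow> 'v \<Rightarrow> complex set" where
  "resP adj p rt = {lam. \<forall>g \<in> l2m adj p rt. \<exists>!f. f \<in> l2m adj p rt \<and> Lop p lam f = g}"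

definition green :: "('v \<Rightarrow> 'v \<Rightarrow> bool) \<Rightarrow> ('v \<Rightarrow> 'v \<Rightarrow> real) \<Rightarrow> 'v \<Rightarrow> complex \<Rightarrow> 'v \<Rightarrow> 'v \<Rightarrow> complex" where
  "green adj p rt lam x y =
     (THE f. f \<in> l2m adj p rt \<and> Lop p lam f = (\<lambda>z. if z = y then 1 else 0)) x"

definition resP_star :: "('v \<Rightarrow> 'v \<Rightarrow> bool) \<Rightarrow> ('v \<Rightarrow> 'v \<Rightarrow> real) \<Rightarrow> 'v \<Rightarrow> complex set" where
  "resP_star adj p rt = {lam \<in> resP adj p rt. \<forall>x. green adj p rt lam x x \<noteq> 0}"

definition Kern :: "('v \<Rightarrow> 'v \<Rightarrow> bool) \<Rightarrow> ('v \<Rightarrow> 'v \<Rightarrow> real) \<Rightarrow> 'v \<Rightarrow> complex \<Rightarrow> 'v \<Rightarrow> (nat \<Rightarrow> 'v) \<Rightarrow> complex" where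
  "Kern adj p rt lam x \<xi> = green adj p rt lam x (confl adj rt x \<xi>) / green adj p rt lam rt (confl adj rt x \<xi>)"

definition Kderiv :: "('v \<Rightarrow> 'v \<Rightarrow> bool) \<Rightarrow> ('v \<Rightarrow> 'v \<Rightarrow> real) \<Rightarrow> 'v \<Rightarrow> nat \<Rightarrow> complex \<Rightarrow> 'v \<Rightarrow> (nat \<Rightarrow> 'v) \<Rightarrow> complex" where
  "Kderiv adj p rt r lam x \<xi> = (deriv ^^ r) (\<lambda>\<mu>. Kern adj p rt \<mu> x \<xi>) lam"

text \<open>A complex distribution, given by its values \<open>\<nu> x = \<nu>(\<partial>T_x)\<close>.\<close>
definition cdist :: "('v \<Rightarrow> 'v \<Rightarrow> bool) \<Rightarrow> 'v \<Rightarrow> ('v \<Rightarrow> complex) \<Rightarrow> bool" where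
  "cdist adj rt \<nu> \<longleftrightarrow> (\<forall>x. (\<lambda>y. norm (\<nu> y)) summable_on children adj rt x \<and> (\<nu> has_sum \<nu> x) (children adj rt x))"

text \<open>Integral of a function \<open>\<phi>\<close> locally constant w.r.t. the finite subtree \<open>\<tau>\<close>: the value
  \<open>\<phi>_x\<close> is taken at a point of \<open>\<partial>T_x\<close> minus the \<open>\<partial>T_y\<close>, \<open>y \<in> \<tau>\<close>, \<open>y\<^sup>- = x\<close> (if that set is
  empty, the corresponding weight vanishes).\<close>
definition loc_integral :: "('v \<Rightarrow> 'v \<Rightarrow> bool) \<Rightarrow> 'v \<Rightarrow> 'v set \<Rightarrow> ((nat \<Rightarrow> 'v) \<Rightarrow> complex) \<Rightarrow> ('v \<Rightarrow> complex) \<Rightarrow> complex" where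
  "loc_integral adj rt \<tau> \<phi> \<nu> =
     (\<Sum>x\<in>\<tau>. \<phi> (SOME \<xi>. \<xi> \<in> bdy adj rt x - (\<Union>y \<in> \<tau> \<inter> children adj rt x. bdy adj rt y)) *
        (\<nu> x - (\<Sum>y \<in> \<tau> \<inter> children adj rt x. \<nu> y)))"

definition Krep :: "('v \<Rightarrow> 'v \<Rightarrow> bool) \<Rightarrow> ('v \<Rightarrow> 'v \<Rightarrow> real) \<Rightarrow> 'v \<Rightarrow> complex \<Rightarrow> nat \<Rightarrow> (nat \<Rightarrow> 'v \<Rightarrow> complex) \<Rightarrow> 'v \<Rightarrow> complex" where
  "Krep adj p rt lam n \<nu> x =
     (\<Sum>r<n. loc_integral adj rt (set (geod adj rt x)) (Kderiv adj p rt r lam x) (\<nu> r))"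

end

theory Submission
  imports Defs "HOL-Complex_Analysis.Laurent_Convergence"
begin

text \<open>
  Write \<open>k\<^sub>v = G(\<cdot>, v) / G(o, v)\<close>. Since \<open>(\<lambda>I - P) k\<^sub>v = 1\<^sub>v / G(o, v)\<close>, the difference
  \<open>D\<^sub>v = k\<^sub>v - k\<^sub>w\<close>, with \<open>w\<close> the parent of \<open>v\<close>, vanishes outside the branch at \<open>v\<close> and satisfies
  \<open>p(w, v) D\<^sub>v(v) = 1 / G(o, w)\<close>. Take Taylor coefficients in \<open>\<lambda>\<close>. Summation by parts along the
  geodesic from \<open>o\<close> to \<open>x\<close> turns the integral of the \<open>r\<close>-th coefficient of the kernel into the
  triangular sum \<open>J\<^sub>r \<nu> (x)\<close> of \<open>D\<^sub>r\<^sub>,\<^sub>v(x) \<nu>(v)\<close> over the vertices \<open>v\<close> of the geodesic, and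
  \<open>(\<lambda>I - P) J\<^sub>r \<nu> = - J\<^sub>r\<^sub>-\<^sub>1 \<nu>\<close> up to a multiple of the defect of \<open>\<nu>\<close>, the difference between
  \<open>\<nu>(x)\<close> and the sum of \<open>\<nu>\<close> over the children of \<open>x\<close>. By triangularity every function is \<open>J\<^sub>0 \<nu>\<close>
  for exactly one \<open>\<nu>\<close>; it is \<open>\<lambda>\<close>-harmonic if and only if the defect vanishes, and the general case
  follows by induction on the order. Analyticity in \<open>\<lambda>\<close> comes from the bounded inverse theorem and
  the Neumann series of the resolvent in \<open>\<ell>\<^sup>2\<close>.
\<close>

section \<open>Inverses of bounded operators on Banach spaces\<close>

lemma norm_funpow_le_onorm:
  fixes T :: "'a::real_normed_vector \<Rightarrow> 'a"
  assumes "bounded_linear T"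
  shows "norm ((T ^^ k) x) \<le> onorm T ^ k * norm x"
proof (induction k)
  case (Suc k)
  have "norm (T ((T ^^ k) x)) \<le> onorm T * norm ((T ^^ k) x)"
    by (rule onorm[OF assms])
  also have "\<dots> \<le> onorm T * (onorm T ^ k * norm x)"
    using Suc.IH onorm_pos_le[OF assms] by (rule mult_left_mono)
  finally show ?case
    by (simp add: mult.assoc)
qed simp

lemma summable_funpow:
  fixes T :: "'a::banach \<Rightarrow> 'a"
  assumes "bounded_linear T" "onorm T < 1"
  shows "summable (\<lambda>k. (T ^^ k) x)"
proof (rule summable_comparison_test')
  show "summable (\<lambda>k. onorm T ^ k * norm x)"
    using assms onorm_pos_le[of T] by (intro summable_mult2 summable_geometric) simp
qed (rule norm_funpow_le_onorm[OF assms(1)])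

theorem neumann_series_iff:
  fixes T :: "'a::banach \<Rightarrow> 'a"
  assumes T: "bounded_linear T" and small: "onorm T < 1"
  shows "x - T x = y \<longleftrightarrow> (\<lambda>k. (T ^^ k) y) sums x"
proof
  have pow_diff: "(T ^^ k) (u - v) = (T ^^ k) u - (T ^^ k) v" for k u v
    by (induction k) (simp_all add: linear_diff[OF bounded_linear.linear[OF T]])
  assume y: "x - T x = y"
  have "(\<lambda>k. (T ^^ k) x - (T ^^ Suc k) x) sums ((T ^^ 0) x - 0)"
    by (rule telescope_sums'[OF summable_LIMSEQ_zero[OF summable_funpow[OF T small]]])
  moreover have "(T ^^ k) x - (T ^^ Suc k) x = (T ^^ k) y" for k
    using pow_diff[of k x "T x"] by (simp only: y funpow.simps comp_apply funpow_swap1)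
  ultimately show "(\<lambda>k. (T ^^ k) y) sums x"
    by (simp only: funpow_0 diff_zero)
next
  assume sums: "(\<lambda>k. (T ^^ k) y) sums x"
  have "(\<lambda>k. (T ^^ Suc k) y) sums T x"
    using bounded_linear.sums[OF T sums] by simp
  then have "(\<lambda>k. (T ^^ k) y) sums (T x + y)"
    using sums_Suc_iff[of "\<lambda>k. (T ^^ k) y" "T x"] by simp
  then have "x = T x + y"
    by (rule sums_unique2[OF sums])
  then show "x - T x = y"
    by (simp add: algebra_simps)
qed

lemma surj_image_cball_somewhere_dense:
  fixes A :: "'a::real_normed_vector \<Rightarrow> 'b::banach"
  assumes "surj A"
  obtains n :: nat and y e where "e > 0" "ball y e \<subseteq> closure (A ` cball 0 (real n))"
proof -
  have cover: "(\<Union>n. closure (A ` cball 0 (real n))) = UNIV"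
  proof (rule subset_antisym[OF subset_UNIV], rule subsetI)
    fix y
    obtain x where "y = A x"
      using \<open>surj A\<close> by blast
    moreover obtain n where "norm x \<le> real n"
      using real_arch_simple by blast
    ultimately show "y \<in> (\<Union>n. closure (A ` cball 0 (real n)))"
      using closure_subset by fastforce
  qed
  have "\<exists>n. interior (closure (A ` cball 0 (real n))) \<noteq> {}"
  proof (rule ccontr)
    assume "\<not> ?thesis"
    then have "Met_TC.mtopology interior_of (\<Union>n. closure (A ` cball 0 (real n))) = {}"
      by (intro Met_TC.metric_Baire_category_alt) (auto simp: complete_UNIV)
    then show False
      by (simp add: cover)
  qed
  then show thesis
    using that by (auto simp: mem_interior)
qed

lemma closure_image_cballE:
  fixes A :: "'a::real_normed_vector \<Rightarrow> 'b::real_normed_vector"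
  assumes "z \<in> closure (A ` cball 0 r)" "d > 0"
  obtains x where "norm x \<le> r" "norm (A x - z) < d"
proof -
  obtain w where "w \<in> A ` cball 0 r" "dist w z < d"
    using assms unfolding closure_approachable by blast
  then show thesis
    using that by (auto simp: dist_norm)
qed

lemma surj_linear_image_cball_dense_near_0:
  fixes A :: "'a::real_normed_vector \<Rightarrow> 'b::banach"
  assumes linear: "linear A" and "surj A"
  obtains r e where "r \<ge> 0" "e > 0" "ball 0 e \<subseteq> closure (A ` cball 0 r)"
proof -
  obtain n :: nat and y e where e: "e > 0" and dense: "ball y e \<subseteq> closure (A ` cball 0 (real n))"
    using surj_image_cball_somewhere_dense[OF \<open>surj A\<close>] .
  have "\<exists>w \<in> A ` cball 0 (2 * real n). dist w z < d" if z: "z \<in> ball 0 e" and "d > 0" for z d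
  proof -
    have "y + z \<in> ball y e" "y \<in> ball y e"
      using z e by (auto simp: dist_norm)
    then have closure: "y + z \<in> closure (A ` cball 0 (real n))" "y \<in> closure (A ` cball 0 (real n))"
      using dense by blast+
    obtain a where a: "norm a \<le> real n" "norm (A a - (y + z)) < d / 2"
      using closure(1) half_gt_zero[OF \<open>d > 0\<close>] by (rule closure_image_cballE)
    obtain b where b: "norm b \<le> real n" "norm (A b - y) < d / 2"
      using closure(2) half_gt_zero[OF \<open>d > 0\<close>] by (rule closure_image_cballE)
    have "norm (A (a - b) - z) = norm ((A a - (y + z)) - (A b - y))"
      by (simp add: linear_diff[OF linear] algebra_simps)
    also have "\<dots> \<le> norm (A a - (y + z)) + norm (A b - y)"
      by (rule norm_triangle_ineq4)
    also have "\<dots> < d"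
      using a(2) b(2) by simp
    finally have "norm (A (a - b) - z) < d" .
    moreover have "a - b \<in> cball 0 (2 * real n)"
      using norm_triangle_ineq4[of a b] a(1) b(1) by simp
    ultimately show ?thesis
      by (intro bexI[of _ "A (a - b)"] imageI) (simp add: dist_norm)
  qed
  then have "ball 0 e \<subseteq> closure (A ` cball 0 (2 * real n))"
    by (intro subsetI closure_approachable[THEN iffD2] allI impI)
  then show thesis
    using that[of "2 * real n" e] e by simp
qed

lemma surj_linear_approximate_preimage:
  fixes A :: "'a::real_normed_vector \<Rightarrow> 'b::banach"
  assumes linear: "linear A" and "surj A"
  obtains C where "C \<ge> 0" "\<And>y. \<exists>x. norm x \<le> C * norm y \<and> norm (y - A x) \<le> norm y / 2"
proof -
  obtain r e where r: "r \<ge> 0" and e: "e > 0" and dense: "ball 0 e \<subseteq> closure (A ` cball 0 r)"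
    using surj_linear_image_cball_dense_near_0[OF assms] .
  have "\<exists>x. norm x \<le> (2 * r / e) * norm y \<and> norm (y - A x) \<le> norm y / 2" for y
  proof (cases "y = 0")
    case True
    then show ?thesis
      by (intro exI[of _ 0]) (simp add: linear_0[OF linear])
  next
    case False
    define s where "s = 2 * norm y / e"
    have s: "s > 0"
      using False e by (simp add: s_def)
    have "norm (y /\<^sub>R s) = e / 2"
      using False e by (simp add: s_def)
    then have "y /\<^sub>R s \<in> closure (A ` cball 0 r)"
      using dense e by auto
    then obtain x where x: "norm x \<le> r" "norm (A x - y /\<^sub>R s) < e / 4"
      by (rule closure_image_cballE[of _ _ _ "e / 4"]) (use e in auto)
    have "y - A (s *\<^sub>R x) = - (s *\<^sub>R (A x - y /\<^sub>R s))"
      using s by (simp add: linear_scale[OF linear] algebra_simps)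
    then have "norm (y - A (s *\<^sub>R x)) \<le> s * (e / 4)"
      using s x(2) by simp
    also have "\<dots> = norm y / 2"
      using e by (simp add: s_def)
    finally have "norm (y - A (s *\<^sub>R x)) \<le> norm y / 2" .
    moreover have "norm (s *\<^sub>R x) \<le> (2 * r / e) * norm y"
      using mult_left_mono[OF x(1), of s] s e by (simp add: s_def mult_ac)
    ultimately show ?thesis
      by blast
  qed
  then show thesis
    using that[of "2 * r / e"] r e by simp
qed

lemma preimage_if_approximate_preimages:
  fixes A :: "'a::banach \<Rightarrow> 'b::real_normed_vector"
  assumes A: "bounded_linear A" and C: "C \<ge> 0"
    and g: "\<And>y. norm (g y) \<le> C * norm y" "\<And>y. norm (y - A (g y)) \<le> norm y / 2"
  shows "\<exists>x. A x = y \<and> norm x \<le> 2 * C * norm y"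
proof -
  define r where "r k = ((\<lambda>z. z - A (g z)) ^^ k) y" for k
  have r_Suc: "r (Suc k) = r k - A (g (r k))" for k
    by (simp add: r_def)
  have r_bound: "norm (r k) \<le> norm y * (1 / 2) ^ k" for k
  proof (induction k)
    case (Suc k)
    then show ?case
      using g(2)[of "r k"] by (simp add: r_Suc)
  qed (simp add: r_def)
  have geometric: "(\<lambda>k. norm y * (1 / 2) ^ k) sums (norm y * 2)"
    using sums_mult[OF geometric_sums[of "1 / 2 :: real"], of "norm y"] by simp
  have g_bound: "norm (g (r k)) \<le> C * (norm y * (1 / 2) ^ k)" for k
    using g(1) mult_left_mono[OF r_bound C] order_trans by blast
  have majorant: "(\<lambda>k. C * (norm y * (1 / 2) ^ k)) sums (C * (norm y * 2))"
    by (rule sums_mult[OF geometric])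
  have "summable (\<lambda>k. g (r k))"
    using g_bound by (rule summable_comparison_test'[OF sums_summable[OF majorant]])
  then have "(\<lambda>k. r k - r (Suc k)) sums A (\<Sum>k. g (r k))"
    using bounded_linear.sums[OF A summable_sums] by (simp add: r_Suc)
  moreover have "r \<longlonglongrightarrow> 0"
    using r_bound by (rule Lim_null_comparison[OF always_eventually[OF allI]
          summable_LIMSEQ_zero[OF sums_summable[OF geometric]]])
  then have "(\<lambda>k. r k - r (Suc k)) sums y"
    using telescope_sums'[of r 0] by (simp add: r_def)
  ultimately have "A (\<Sum>k. g (r k)) = y"
    by (rule sums_unique2)
  moreover have "norm (\<Sum>k. g (r k)) \<le> 2 * C * norm y"
    using norm_suminf_le[OF g_bound sums_summable[OF majorant]] sums_unique[OF majorant] by simp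
  ultimately show ?thesis
    by blast
qed

theorem surj_bounded_linear_preimage_bound:
  fixes A :: "'a::banach \<Rightarrow> 'b::banach"
  assumes A: "bounded_linear A" and "surj A"
  obtains C where "\<And>y. \<exists>x. A x = y \<and> norm x \<le> C * norm y"
proof -
  obtain C where C: "C \<ge> 0" and "\<And>y. \<exists>x. norm x \<le> C * norm y \<and> norm (y - A x) \<le> norm y / 2"
    using surj_linear_approximate_preimage[OF bounded_linear.linear[OF A] \<open>surj A\<close>] by blast
  then obtain g where g: "\<And>y. norm (g y) \<le> C * norm y" "\<And>y. norm (y - A (g y)) \<le> norm y / 2"
    by metis
  show thesis
    by (rule that[OF preimage_if_approximate_preimages[OF A C g]])
qed

corollary bounded_linear_inv:
  fixes A :: "'a::banach \<Rightarrow> 'b::banach"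
  assumes A: "bounded_linear A" and bij: "bij A"
  shows "bounded_linear (inv A)"
proof -
  obtain C where C: "\<And>y. \<exists>x. A x = y \<and> norm x \<le> C * norm y"
    using surj_bounded_linear_preimage_bound[OF A bij_is_surj[OF bij]] by blast
  have inv_A_eq: "inv A y = x" if "A x = y" for x y
    using that bij_is_inj[OF bij] by (simp add: inv_f_eq)
  have A_inv: "A (inv A y) = y" for y
    by (rule surj_f_inv_f[OF bij_is_surj[OF bij]])
  show ?thesis
  proof (rule bounded_linear_intro)
    show "inv A (y + z) = inv A y + inv A z" for y z
      by (rule inv_A_eq) (simp add: A_inv linear_add[OF bounded_linear.linear[OF A]])
    show "inv A (r *\<^sub>R y) = r *\<^sub>R inv A y" for r y
      by (rule inv_A_eq) (simp add: A_inv linear_scale[OF bounded_linear.linear[OF A]])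
    show "norm (inv A y) \<le> norm y * C" for y
      using C[of y] inv_A_eq by (auto simp: mult.commute)
  qed
qed

section \<open>The Hilbert space of square summable functions\<close>

definition sq_summable :: "('i \<Rightarrow> 'b::real_normed_vector) \<Rightarrow> bool" where
  "sq_summable f \<longleftrightarrow> (\<lambda>i. (norm (f i))\<^sup>2) summable_on UNIV"

lemma sq_summable_zero: "sq_summable (\<lambda>_. 0)"
  by (simp add: sq_summable_def)

lemma sq_summable_add:
  fixes f g :: "'i \<Rightarrow> 'b::real_normed_vector"
  assumes "sq_summable f" "sq_summable g"
  shows "sq_summable (\<lambda>i. f i + g i)"
  unfolding sq_summable_def
proof (rule summable_on_comparison_test)
  show "(\<lambda>i. 2 * (norm (f i))\<^sup>2 + 2 * (norm (g i))\<^sup>2) summable_on UNIV"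
    using assms unfolding sq_summable_def by (intro summable_on_add summable_on_cmult_right)
  show "(norm (f i + g i))\<^sup>2 \<le> 2 * (norm (f i))\<^sup>2 + 2 * (norm (g i))\<^sup>2" for i
  proof -
    have "(norm (f i + g i))\<^sup>2 \<le> (norm (f i) + norm (g i))\<^sup>2"
      by (intro power_mono norm_triangle_ineq) simp
    then show ?thesis
      using sum_squares_bound[of "norm (f i)" "norm (g i)"] by (simp add: power2_sum)
  qed
qed simp

lemma sq_summable_bounded_image:
  fixes f :: "'i \<Rightarrow> 'b::real_normed_vector" and g :: "'i \<Rightarrow> 'c::real_normed_vector"
  assumes "sq_summable f" and bound: "\<And>i. norm (g i) \<le> C * norm (f i)"
  shows "sq_summable g"
  unfolding sq_summable_def
proof (rule summable_on_comparison_test)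
  show "(\<lambda>i. C\<^sup>2 * (norm (f i))\<^sup>2) summable_on UNIV"
    using assms(1) unfolding sq_summable_def by (rule summable_on_cmult_right)
  show "(norm (g i))\<^sup>2 \<le> C\<^sup>2 * (norm (f i))\<^sup>2" for i
    using power_mono[OF bound norm_ge_zero, of i 2] by (simp add: power_mult_distrib)
qed simp

lemma sq_summable_scaleR: "sq_summable f \<Longrightarrow> sq_summable (\<lambda>i. r *\<^sub>R f i)"
  by (rule sq_summable_bounded_image[of f _ "\<bar>r\<bar>"]) auto

lemma sq_summable_mult:
  fixes f :: "'i \<Rightarrow> complex"
  shows "sq_summable f \<Longrightarrow> sq_summable (\<lambda>i. c * f i)"
  by (rule sq_summable_bounded_image[of f _ "cmod c"]) (auto simp: norm_mult)

lemma abs_summable_inner: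
  fixes f g :: "'i \<Rightarrow> 'b::real_inner"
  assumes "sq_summable f" "sq_summable g"
  shows "(\<lambda>i. norm (inner (f i) (g i))) summable_on UNIV"
proof (rule Infinite_Sum.abs_summable_on_comparison_test)
  show "(\<lambda>i. norm (norm (f i) * norm (g i))) summable_on UNIV"
    by (rule abs_summable_product)
      (use assms in \<open>simp_all add: sq_summable_def power2_eq_square\<close>)
qed (simp add: Cauchy_Schwarz_ineq2)

lemma summable_inner:
  "sq_summable f \<Longrightarrow> sq_summable g \<Longrightarrow> (\<lambda>i. inner (f i) (g i)) summable_on UNIV"
  by (rule abs_summable_summable[OF abs_summable_inner])

typedef (overloaded) ('i, 'b::real_inner) ell2 = "{f :: 'i \<Rightarrow> 'b. sq_summable f}"
  morphisms apply_ell2 Abs_ell2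
  using sq_summable_zero by blast

setup_lifting type_definition_ell2

instantiation ell2 :: (type, real_inner) real_vector
begin

lift_definition zero_ell2 :: "('a, 'b) ell2" is "\<lambda>_. 0"
  by (rule sq_summable_zero)

lift_definition plus_ell2 :: "('a, 'b) ell2 \<Rightarrow> ('a, 'b) ell2 \<Rightarrow> ('a, 'b) ell2" is "\<lambda>f g i. f i + g i"
  by (rule sq_summable_add)

lift_definition uminus_ell2 :: "('a, 'b) ell2 \<Rightarrow> ('a, 'b) ell2" is "\<lambda>f i. - f i"
  by (simp add: sq_summable_def)

lift_definition scaleR_ell2 :: "real \<Rightarrow> ('a, 'b) ell2 \<Rightarrow> ('a, 'b) ell2" is "\<lambda>r f i. r *\<^sub>R f i"
  by (rule sq_summable_scaleR)

lift_definition minus_ell2 :: "('a, 'b) ell2 \<Rightarrow> ('a, 'b) ell2 \<Rightarrow> ('a, 'b) ell2" is "\<lambda>f g i. f i - g i"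
  using sq_summable_add sq_summable_scaleR[of _ "-1"] by fastforce

instance
  by standard (transfer; auto simp: algebra_simps)+

end

instantiation ell2 :: (type, real_inner) real_inner
begin

lift_definition inner_ell2 :: "('a, 'b) ell2 \<Rightarrow> ('a, 'b) ell2 \<Rightarrow> real"
  is "\<lambda>f g. \<Sum>\<^sub>\<infinity>i. inner (f i) (g i)" .

definition norm_ell2 :: "('a, 'b) ell2 \<Rightarrow> real" where
  "norm_ell2 f = sqrt (inner f f)"

definition dist_ell2 :: "('a, 'b) ell2 \<Rightarrow> ('a, 'b) ell2 \<Rightarrow> real" where
  "dist_ell2 f g = norm (f - g)"

definition sgn_ell2 :: "('a, 'b) ell2 \<Rightarrow> ('a, 'b) ell2" where
  "sgn_ell2 f = f /\<^sub>R norm f"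

definition uniformity_ell2 :: "(('a, 'b) ell2 \<times> ('a, 'b) ell2) filter" where
  "uniformity_ell2 = (INF e\<in>{0<..}. principal {(f, g). dist f g < e})"

definition open_ell2 :: "('a, 'b) ell2 set \<Rightarrow> bool" where
  "open_ell2 U = (\<forall>f\<in>U. eventually (\<lambda>(f', g). f' = f \<longrightarrow> g \<in> U) uniformity)"

instance
proof
  fix f g h :: "('a, 'b) ell2" and r :: real
  show "inner f g = inner g f"
    by transfer (simp add: inner_commute)
  show "inner (f + g) h = inner f h + inner g h"
    by transfer (simp add: inner_add_left infsum_add summable_inner)
  show "inner (r *\<^sub>R f) g = r * inner f g"
    by transfer (simp add: infsum_cmult_right')
  show "0 \<le> inner f f"
    by transfer (simp add: infsum_nonneg)
  show "inner f f = 0 \<longleftrightarrow> f = 0"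
  proof
    show "inner f f = 0 \<Longrightarrow> f = 0"
    proof transfer
      fix f :: "'a \<Rightarrow> 'b"
      assume "sq_summable f" "(\<Sum>\<^sub>\<infinity>i. inner (f i) (f i)) = 0"
      then have "inner (f i) (f i) = 0" for i
        using nonneg_infsum_le_0D[of "\<lambda>i. inner (f i) (f i)" UNIV] summable_inner[of f f] by simp
      then show "f = (\<lambda>_. 0)"
        by auto
    qed
  qed (transfer, simp)
qed (rule norm_ell2_def dist_ell2_def sgn_ell2_def uniformity_ell2_def open_ell2_def)+

end

lemma apply_ell2_simps:
  "apply_ell2 0 i = 0"
  "apply_ell2 (f + g) i = apply_ell2 f i + apply_ell2 g i"
  "apply_ell2 (f - g) i = apply_ell2 f i - apply_ell2 g i"
  "apply_ell2 (r *\<^sub>R f) i = r *\<^sub>R apply_ell2 f i"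
  by (transfer; simp)+

lemma ell2_eqI: "(\<And>i. apply_ell2 f i = apply_ell2 g i) \<Longrightarrow> f = g"
  by transfer auto

lemma norm_square_ell2: "(norm f)\<^sup>2 = (\<Sum>\<^sub>\<infinity>i. (norm (apply_ell2 f i))\<^sup>2)"
  by (simp add: power2_norm_eq_inner inner_ell2.rep_eq)

lemma sum_norm_square_le_ell2:
  "finite F \<Longrightarrow> (\<Sum>i\<in>F. (norm (apply_ell2 f i))\<^sup>2) \<le> (norm f)\<^sup>2"
  unfolding norm_square_ell2
  using apply_ell2[of f] by (intro finite_sum_le_infsum) (auto simp: sq_summable_def)

lemma norm_apply_ell2_le: "norm (apply_ell2 f i) \<le> norm f"
  by (rule power2_le_imp_le) (use sum_norm_square_le_ell2[of "{i}" f] in simp_all)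

lemma bounded_linear_apply_ell2: "bounded_linear (\<lambda>f. apply_ell2 f i)"
  by (rule bounded_linear_intro[of _ 1]) (simp_all add: apply_ell2_simps norm_apply_ell2_le)

lemma ell2_pointwise_limit:
  fixes X :: "nat \<Rightarrow> ('i, 'b::real_inner) ell2"
  assumes lim: "\<And>i. (\<lambda>n. apply_ell2 (X n) i) \<longlonglongrightarrow> l i"
    and bound: "eventually (\<lambda>n. norm (X n) \<le> B) sequentially"
  obtains f where "apply_ell2 f = l" "norm f \<le> B"
proof -
  obtain n where "norm (X n) \<le> B"
    using eventually_happens[OF bound] by auto
  then have "B \<ge> 0"
    using norm_ge_zero order_trans by blast
  have finite_sum: "(\<Sum>i\<in>F. (norm (l i))\<^sup>2) \<le> B\<^sup>2" if "finite F" for F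
  proof (rule tendsto_upperbound)
    show "(\<lambda>n. \<Sum>i\<in>F. (norm (apply_ell2 (X n) i))\<^sup>2) \<longlonglongrightarrow> (\<Sum>i\<in>F. (norm (l i))\<^sup>2)"
      by (intro tendsto_intros lim)
    show "eventually (\<lambda>n. (\<Sum>i\<in>F. (norm (apply_ell2 (X n) i))\<^sup>2) \<le> B\<^sup>2) sequentially"
      using bound
    proof eventually_elim
      case (elim n)
      then show ?case
        using sum_norm_square_le_ell2[OF that, of "X n"] power_mono[OF elim norm_ge_zero, of 2]
        by simp
    qed
  qed simp
  then have "sq_summable l"
    unfolding sq_summable_def by (intro nonneg_bdd_above_summable_on) (auto intro!: bdd_aboveI)
  then have l: "apply_ell2 (Abs_ell2 l) = l"
    by (simp add: Abs_ell2_inverse)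
  have "(norm (Abs_ell2 l))\<^sup>2 \<le> B\<^sup>2"
    unfolding norm_square_ell2 l using \<open>sq_summable l\<close> finite_sum
    by (intro infsum_le_finite_sums) (auto simp: sq_summable_def)
  then show thesis
    using that l \<open>B \<ge> 0\<close> power2_le_imp_le by blast
qed

lemma ell2_pointwise_limit_dist:
  fixes X :: "nat \<Rightarrow> ('i, 'b::real_inner) ell2"
  assumes lim: "\<And>i. (\<lambda>n. apply_ell2 (X n) i) \<longlonglongrightarrow> l i"
    and bound: "eventually (\<lambda>n. norm (X n - Y) \<le> B) sequentially"
  obtains f where "apply_ell2 f = l" "norm (f - Y) \<le> B"
proof -
  have "(\<lambda>n. apply_ell2 (X n - Y) i) \<longlonglongrightarrow> l i - apply_ell2 Y i" for i
    unfolding apply_ell2_simps by (intro tendsto_intros lim)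
  then obtain f where f: "apply_ell2 f = (\<lambda>i. l i - apply_ell2 Y i)" "norm f \<le> B"
    using bound by (rule ell2_pointwise_limit)
  then have "apply_ell2 (Y + f) = l"
    by (auto simp: apply_ell2_simps)
  then show thesis
    using f(2) by (intro that[of "Y + f"]) simp_all
qed

lemma Cauchy_ell2_pointwise_limit:
  fixes X :: "nat \<Rightarrow> ('i, 'b::real_inner) ell2"
  assumes "Cauchy X" and lim: "\<And>i. (\<lambda>n. apply_ell2 (X n) i) \<longlonglongrightarrow> l i" and "e > 0"
  shows "\<exists>N. \<forall>m\<ge>N. \<exists>f. apply_ell2 f = l \<and> norm (f - X m) \<le> e"
proof -
  obtain N where N: "\<And>m n. m \<ge> N \<Longrightarrow> n \<ge> N \<Longrightarrow> norm (X n - X m) < e"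
    using \<open>Cauchy X\<close> \<open>e > 0\<close> unfolding Cauchy_def dist_norm by meson
  have "\<exists>f. apply_ell2 f = l \<and> norm (f - X m) \<le> e" if m: "m \<ge> N" for m
  proof -
    have "eventually (\<lambda>n. norm (X n - X m) \<le> e) sequentially"
      by (rule eventually_sequentiallyI[of N]) (rule less_imp_le[OF N[OF m]])
    then show ?thesis
      by (rule ell2_pointwise_limit_dist[OF lim]) blast
  qed
  then show ?thesis
    by blast
qed

instance ell2 :: (type, "{real_inner, banach}") banach
proof
  fix X :: "nat \<Rightarrow> ('a, 'b) ell2"
  assume Cauchy: "Cauchy X"
  have "convergent (\<lambda>n. apply_ell2 (X n) i)" for i
    by (rule Cauchy_convergent[OF bounded_linear.Cauchy[OF bounded_linear_apply_ell2 Cauchy]])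
  then obtain l where l: "\<And>i. (\<lambda>n. apply_ell2 (X n) i) \<longlonglongrightarrow> l i"
    unfolding convergent_def by metis
  obtain f where f: "apply_ell2 f = l"
    using Cauchy_ell2_pointwise_limit[OF Cauchy l zero_less_one] by blast
  have "X \<longlonglongrightarrow> f"
  proof (rule metric_LIMSEQ_I)
    fix e :: real
    assume "e > 0"
    then obtain N where N: "\<forall>m\<ge>N. \<exists>g. apply_ell2 g = l \<and> norm (g - X m) \<le> e / 2"
      using Cauchy_ell2_pointwise_limit[OF Cauchy l half_gt_zero] by blast
    have "dist (X m) f < e" if m: "m \<ge> N" for m
    proof -
      obtain g where g: "apply_ell2 g = l" "norm (g - X m) \<le> e / 2"
        using N m by blast
      have "g = f"
        by (rule ell2_eqI) (simp only: f g(1))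
      then have "dist (X m) f \<le> e / 2"
        using g(2) by (simp only: dist_norm norm_minus_commute)
      then show ?thesis
        using \<open>e > 0\<close> by simp
    qed
    then show "\<exists>N. \<forall>m\<ge>N. dist (X m) f < e"
      by blast
  qed
  then show "convergent X"
    by (auto simp: convergent_def)
qed

lift_definition scaleC_ell2 :: "complex \<Rightarrow> ('i, complex) ell2 \<Rightarrow> ('i, complex) ell2"
  is "\<lambda>c f i. c * f i"
  by (rule sq_summable_mult)

lemma norm_scaleC_ell2: "norm (scaleC_ell2 c f) = cmod c * norm f"
proof -
  have "(norm (scaleC_ell2 c f))\<^sup>2 = (cmod c * norm f)\<^sup>2"
    by (simp add: norm_square_ell2 scaleC_ell2.rep_eq norm_mult power_mult_distrib infsum_cmult_right')
  then show ?thesis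
    by (simp add: power2_eq_imp_eq)
qed

lemma bounded_linear_scaleC_ell2: "bounded_linear (scaleC_ell2 c)"
  by (rule bounded_linear_intro[of _ "cmod c"])
    (auto simp: norm_scaleC_ell2 scaleC_ell2.rep_eq apply_ell2_simps algebra_simps intro!: ell2_eqI)

section \<open>Resolvents of Markov kernels with an invariant measure\<close>

lemma Pdefined_iff: "Pdefined p f \<longleftrightarrow> (\<forall>x. (\<lambda>y. complex_of_real (p x y) * f y) summable_on UNIV)"
  unfolding Pdefined_def summable_on_iff_abs_summable_on_complex ..

lemma has_sum_Pop: "Pdefined p f \<Longrightarrow> ((\<lambda>y. complex_of_real (p x y) * f y) has_sum Pop p f x) UNIV"
  by (simp add: Pdefined_iff Pop_def)

lemma Pop_eqI: "((\<lambda>y. complex_of_real (p x y) * f y) has_sum s) UNIV \<Longrightarrow> Pop p f x = s"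
  by (simp add: Pop_def infsumI)

lemma Pop_add:
  "Pdefined p f \<Longrightarrow> Pdefined p g \<Longrightarrow> Pop p (\<lambda>x. f x + g x) x = Pop p f x + Pop p g x"
  unfolding Pop_def Pdefined_iff by (simp add: distrib_left infsum_add)

lemma Pop_cmult: "Pop p (\<lambda>x. a * f x) x = a * Pop p f x"
  unfolding Pop_def by (simp add: infsum_cmult_right' mult.left_commute)

lemma Pdefined_zero: "Pdefined p (\<lambda>_. 0)"
  by (simp add: Pdefined_iff)

lemma Pdefined_add: "Pdefined p f \<Longrightarrow> Pdefined p g \<Longrightarrow> Pdefined p (\<lambda>x. f x + g x)"
  by (simp add: Pdefined_iff distrib_left summable_on_add)

lemma Pdefined_cmult: "Pdefined p f \<Longrightarrow> Pdefined p (\<lambda>x. a * f x)"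
  unfolding Pdefined_iff mult.left_commute[of _ a] by (intro allI summable_on_cmult_right) auto

lemma Pdefined_diff: "Pdefined p f \<Longrightarrow> Pdefined p g \<Longrightarrow> Pdefined p (\<lambda>x. f x - g x)"
  using Pdefined_add[of p f "\<lambda>x. -1 * g x"] Pdefined_cmult[of p g "-1"] by simp

lemma Pdefined_sum: "(\<And>i. i \<in> I \<Longrightarrow> Pdefined p (f i)) \<Longrightarrow> Pdefined p (\<lambda>x. \<Sum>i\<in>I. f i x)"
  by (induction I rule: infinite_finite_induct) (auto intro: Pdefined_add Pdefined_zero)

lemma Lop_zero: "Lop p \<mu> (\<lambda>_. 0) x = 0"
  by (simp add: Lop_def Pop_def)

lemma Lop_add:
  "Pdefined p f \<Longrightarrow> Pdefined p g \<Longrightarrow> Lop p \<mu> (\<lambda>x. f x + g x) x = Lop p \<mu> f x + Lop p \<mu> g x"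
  by (simp add: Lop_def Pop_add algebra_simps)

lemma Lop_cmult: "Lop p \<mu> (\<lambda>x. a * f x) x = a * Lop p \<mu> f x"
  by (simp add: Lop_def Pop_cmult algebra_simps)

lemma Lop_diff:
  "Pdefined p f \<Longrightarrow> Pdefined p g \<Longrightarrow> Lop p \<mu> (\<lambda>x. f x - g x) x = Lop p \<mu> f x - Lop p \<mu> g x"
  using Lop_add[of p f "\<lambda>x. -1 * g x"] Pdefined_cmult[of p g "-1"] Lop_cmult[of p \<mu> "-1" g] by simp

lemma Lop_sum:
  "(\<And>i. i \<in> I \<Longrightarrow> Pdefined p (f i)) \<Longrightarrow> Lop p \<mu> (\<lambda>x. \<Sum>i\<in>I. f i x) x = (\<Sum>i\<in>I. Lop p \<mu> (f i) x)"
  by (induction I rule: infinite_finite_induct) (auto simp: Lop_add Pdefined_sum Lop_zero)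

lemma
  fixes q :: "'i \<Rightarrow> real" and u :: "'i \<Rightarrow> complex"
  assumes nonneg: "\<And>i. q i \<ge> 0" and q: "(q has_sum s) UNIV"
    and u: "(\<lambda>i. q i * (cmod (u i))\<^sup>2) summable_on UNIV"
  shows abs_summable_if_weighted_square_summable:
      "(\<lambda>i. norm (of_real (q i) * u i)) summable_on UNIV"
    and weighted_Cauchy_Schwarz:
      "(cmod (\<Sum>\<^sub>\<infinity>i. of_real (q i) * u i))\<^sup>2 \<le> s * (\<Sum>\<^sub>\<infinity>i. q i * (cmod (u i))\<^sup>2)"
proof -
  define a b where "a = Abs_ell2 (\<lambda>i. sqrt (q i))" and "b = Abs_ell2 (\<lambda>i. sqrt (q i) * cmod (u i))"
  have "sq_summable (\<lambda>i. sqrt (q i))" "sq_summable (\<lambda>i. sqrt (q i) * cmod (u i))"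
    using has_sum_imp_summable[OF q] u nonneg by (simp_all add: sq_summable_def power_mult_distrib)
  then have apply_ab: "apply_ell2 a
      = (\<lambda>i. sqrt (q i))" "apply_ell2 b = (\<lambda>i. sqrt (q i) * cmod (u i))"
    by (simp_all add: a_def b_def Abs_ell2_inverse)
  have term_eq: "apply_ell2 a i * apply_ell2 b i = norm (of_real (q i) * u i)" for i
    using nonneg[of i] by (simp add: apply_ab norm_mult flip: mult.assoc)
  show summable: "(\<lambda>i. norm (of_real (q i) * u i)) summable_on UNIV"
    using summable_inner[of "apply_ell2 a" "apply_ell2 b"] apply_ell2[of a] apply_ell2[of b]
    by (simp add: term_eq)
  have "cmod (\<Sum>\<^sub>\<infinity>i. of_real (q i) * u i) \<le> inner a b"
    using norm_infsum_bound[OF summable] by (simp add: inner_ell2.rep_eq term_eq)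
  then have "(cmod (\<Sum>\<^sub>\<infinity>i. of_real (q i) * u i))\<^sup>2 \<le> (inner a b)\<^sup>2"
    by (rule power_mono) simp
  also have "\<dots> \<le> inner a a * inner b b"
    by (rule Cauchy_Schwarz_ineq)
  also have "\<dots> = s * (\<Sum>\<^sub>\<infinity>i. q i * (cmod (u i))\<^sup>2)"
  proof -
    have "inner b b = (\<Sum>\<^sub>\<infinity>i. q i * (cmod (u i))\<^sup>2)"
      by (simp add: power_mult_distrib norm_square_ell2 apply_ab nonneg flip: power2_norm_eq_inner)
    moreover have "inner a a = s"
      using infsumI[OF q] by (simp add: norm_square_ell2 apply_ab nonneg flip: power2_norm_eq_inner)
    ultimately show ?thesis
      by simp
  qed
  finally show "(cmod (\<Sum>\<^sub>\<infinity>i. of_real (q i) * u i))\<^sup>2 \<le> s * (\<Sum>\<^sub>\<infinity>i. q i * (cmod (u i))\<^sup>2)" .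
qed

locale invariant_kernel =
  fixes p :: "'v \<Rightarrow> 'v \<Rightarrow> real" and m :: "'v \<Rightarrow> real"
  assumes p_nonneg: "0 \<le> p x y"
    and p_sum: "(p x has_sum 1) UNIV"
    and m_pos: "0 < m x"
    and invariant: "((\<lambda>x. m x * p x y) has_sum m y) UNIV"
begin

definition wl2 :: "('v \<Rightarrow> complex) set" where
  "wl2 = {u. (\<lambda>x. (cmod (u x))\<^sup>2 * m x) summable_on UNIV}"

definition to_ell2 :: "('v \<Rightarrow> complex) \<Rightarrow> ('v, complex) ell2" where
  "to_ell2 u = Abs_ell2 (\<lambda>x. of_real (sqrt (m x)) * u x)"

definition of_ell2 :: "('v, complex) ell2 \<Rightarrow> 'v \<Rightarrow> complex" where
  "of_ell2 f x = apply_ell2 f x / of_real (sqrt (m x))"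

lemma m_simps [simp]: "0 < m x" "m x \<noteq> 0" "0 \<le> m x"
  using m_pos[of x] by auto

lemma wl2_iff_sq_summable: "u \<in> wl2 \<longleftrightarrow> sq_summable (\<lambda>x. of_real (sqrt (m x)) * u x)"
  unfolding wl2_def sq_summable_def by (simp add: norm_mult power_mult_distrib mult.commute)

lemma apply_to_ell2: "u \<in> wl2 \<Longrightarrow> apply_ell2 (to_ell2 u) x = of_real (sqrt (m x)) * u x"
  by (simp add: to_ell2_def Abs_ell2_inverse wl2_iff_sq_summable)

lemma norm_square_to_ell2: "u \<in> wl2 \<Longrightarrow> (norm (to_ell2 u))\<^sup>2 = (\<Sum>\<^sub>\<infinity>x. (cmod (u x))\<^sup>2 * m x)"
  by (simp add: norm_square_ell2 apply_to_ell2 norm_mult power_mult_distrib mult.commute)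

lemma of_ell2_in_wl2: "of_ell2 f \<in> wl2"
  using apply_ell2[of f] by (simp add: wl2_iff_sq_summable of_ell2_def)

lemma of_to_ell2: "u \<in> wl2 \<Longrightarrow> of_ell2 (to_ell2 u) = u"
  by (auto simp: of_ell2_def apply_to_ell2)

lemma to_of_ell2: "to_ell2 (of_ell2 f) = f"
  by (rule ell2_eqI) (simp add: apply_to_ell2[OF of_ell2_in_wl2] of_ell2_def)

lemma of_ell2_simps:
  "of_ell2 (f + g) = (\<lambda>x. of_ell2 f x + of_ell2 g x)"
  "of_ell2 (f - g) = (\<lambda>x. of_ell2 f x - of_ell2 g x)"
  "of_ell2 (r *\<^sub>R f) = (\<lambda>x. of_real r * of_ell2 f x)"
  "of_ell2 (scaleC_ell2 c f) = (\<lambda>x. c * of_ell2 f x)"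
  by (auto simp: of_ell2_def apply_ell2_simps scaleC_ell2.rep_eq add_divide_distrib diff_divide_distrib
      scaleR_conv_of_real)

lemma of_ell2_inject: "of_ell2 f = of_ell2 g \<longleftrightarrow> f = g"
  using to_of_ell2 by metis

lemma wl2_diff: "u \<in> wl2 \<Longrightarrow> v \<in> wl2 \<Longrightarrow> (\<lambda>x. u x - v x) \<in> wl2"
  using of_ell2_in_wl2[of "to_ell2 u - to_ell2 v"] by (simp add: of_ell2_simps of_to_ell2)

lemma wl2_cmult: "u \<in> wl2 \<Longrightarrow> (\<lambda>x. c * u x) \<in> wl2"
  using of_ell2_in_wl2[of "scaleC_ell2 c (to_ell2 u)"] by (simp add: of_ell2_simps of_to_ell2)

lemma wl2_cut: "u \<in> wl2 \<Longrightarrow> (\<lambda>x. if Q x then 0 else u x) \<in> wl2"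
  unfolding wl2_def mem_Collect_eq by (erule summable_on_comparison_test) auto

lemma wl2_indicator: "(\<lambda>x. if x = y then 1 else 0) \<in> wl2"
  unfolding wl2_def
  by (auto intro!: finite_nonzero_values_imp_summable_on finite_subset[of _ "{y}"] split: if_splits)

lemma has_sum_transported_mass:
  assumes "u \<in> wl2"
  shows "((\<lambda>(x, y). m x * (p x y * (cmod (u y))\<^sup>2))
      has_sum (\<Sum>\<^sub>\<infinity>y. (cmod (u y))\<^sup>2 * m y)) (UNIV \<times> UNIV)"
proof -
  let ?h = "\<lambda>(y, x). m x * (p x y * (cmod (u y))\<^sup>2)"
  have column: "((\<lambda>x. ?h (y, x)) has_sum (cmod (u y))\<^sup>2 * m y) UNIV" for y
    using has_sum_cmult_right[OF invariant, of "(cmod (u y))\<^sup>2" y] by (simp add: mult_ac)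
  have "(\<lambda>y. (cmod (u y))\<^sup>2 * m y) summable_on UNIV"
    using assms by (simp add: wl2_def)
  moreover from this have "?h summable_on UNIV \<times> UNIV"
    by (rule summable_on_SigmaI[OF column]) (simp add: p_nonneg)
  ultimately have "(?h has_sum (\<Sum>\<^sub>\<infinity>y. (cmod (u y))\<^sup>2 * m y)) (UNIV \<times> UNIV)"
    using column by (intro has_sum_SigmaI[of UNIV ?h]) auto
  then show ?thesis
    by (subst has_sum_swap) (simp add: case_prod_unfold)
qed

lemma summable_p_square:
  assumes "u \<in> wl2"
  shows "(\<lambda>y. p x y * (cmod (u y))\<^sup>2) summable_on UNIV"
proof -
  have "(\<lambda>y. m x * (p x y * (cmod (u y))\<^sup>2)) summable_on UNIV"
    using has_sum_imp_summable[OF has_sum_transported_mass[OF assms]]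
    by (rule summable_on_SigmaD1) simp
  then show ?thesis
    by (simp add: summable_on_cmult_right')
qed

lemma Pdefined_wl2: "u \<in> wl2 \<Longrightarrow> Pdefined p u"
  unfolding Pdefined_def
  using abs_summable_if_weighted_square_summable[OF p_nonneg p_sum summable_p_square] by blast

lemma norm_Pop_square_le: "u \<in> wl2 \<Longrightarrow> (cmod (Pop p u x))\<^sup>2 \<le> (\<Sum>\<^sub>\<infinity>y. p x y * (cmod (u y))\<^sup>2)"
  unfolding Pop_def
  using weighted_Cauchy_Schwarz[OF p_nonneg p_sum summable_p_square] by simp

lemma
  assumes u: "u \<in> wl2"
  shows Pop_in_wl2: "Pop p u \<in> wl2"
    and norm_Pop_le: "(\<Sum>\<^sub>\<infinity>x. (cmod (Pop p u x))\<^sup>2 * m x) \<le> (\<Sum>\<^sub>\<infinity>x. (cmod (u x))\<^sup>2 * m x)"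
proof -
  let ?row = "\<lambda>x. m x * (\<Sum>\<^sub>\<infinity>y. p x y * (cmod (u y))\<^sup>2)"
  have rows: "(?row has_sum (\<Sum>\<^sub>\<infinity>x. (cmod (u x))\<^sup>2 * m x)) UNIV"
    by (rule has_sum_SigmaD[OF has_sum_transported_mass[OF u]])
      (simp add: has_sum_cmult_right summable_p_square[OF u])
  have row_bound: "(cmod (Pop p u x))\<^sup>2 * m x \<le> ?row x" for x
    using norm_Pop_square_le[OF u] by (simp add: mult.commute mult_left_mono)
  show "Pop p u \<in> wl2"
    unfolding wl2_def mem_Collect_eq
    by (rule summable_on_comparison_test[OF has_sum_imp_summable[OF rows] row_bound]) simp
  then show "(\<Sum>\<^sub>\<infinity>x. (cmod (Pop p u x))\<^sup>2 * m x) \<le> (\<Sum>\<^sub>\<infinity>x. (cmod (u x))\<^sup>2 * m x)"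
    unfolding infsumI[OF rows, symmetric] wl2_def mem_Collect_eq
    by (rule infsum_mono[OF _ has_sum_imp_summable[OF rows] row_bound])
qed

definition P_ell2 :: "('v, complex) ell2 \<Rightarrow> ('v, complex) ell2" where
  "P_ell2 f = to_ell2 (Pop p (of_ell2 f))"

definition L_ell2 :: "complex \<Rightarrow> ('v, complex) ell2 \<Rightarrow> ('v, complex) ell2" where
  "L_ell2 \<mu> f = scaleC_ell2 \<mu> f - P_ell2 f"

lemma of_ell2_P: "of_ell2 (P_ell2 f) = Pop p (of_ell2 f)"
  by (simp add: P_ell2_def of_to_ell2 Pop_in_wl2 of_ell2_in_wl2)

lemma of_ell2_L: "of_ell2 (L_ell2 \<mu> f) = Lop p \<mu> (of_ell2 f)"
  by (simp add: L_ell2_def of_ell2_simps of_ell2_P Lop_def fun_eq_iff)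

lemma L_ell2_scaleC: "L_ell2 \<mu> (scaleC_ell2 c f) = scaleC_ell2 c (L_ell2 \<mu> f)"
  by (subst of_ell2_inject[symmetric]) (simp add: of_ell2_L of_ell2_simps Lop_cmult fun_eq_iff)

lemma bounded_linear_P_ell2: "bounded_linear P_ell2"
proof (rule bounded_linear_intro[of _ 1])
  show "P_ell2 (f + g) = P_ell2 f + P_ell2 g" for f g
    by (subst of_ell2_inject[symmetric])
      (simp add: of_ell2_P of_ell2_simps Pop_add Pdefined_wl2 of_ell2_in_wl2 fun_eq_iff)
  show "P_ell2 (r *\<^sub>R f) = r *\<^sub>R P_ell2 f" for r f
    by (subst of_ell2_inject[symmetric]) (simp add: of_ell2_P of_ell2_simps Pop_cmult fun_eq_iff)
  have "(norm (P_ell2 f))\<^sup>2 \<le> (norm (to_ell2 (of_ell2 f)))\<^sup>2" for f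
    unfolding P_ell2_def by (simp add: norm_square_to_ell2 of_ell2_in_wl2 Pop_in_wl2 norm_Pop_le)
  then show "norm (P_ell2 f) \<le> norm f * 1" for f
    by (simp add: to_of_ell2)
qed

lemma bounded_linear_L_ell2: "bounded_linear (L_ell2 \<mu>)"
  unfolding L_ell2_def
  by (intro bounded_linear_sub bounded_linear_scaleC_ell2 bounded_linear_P_ell2)

definition resolvent_set :: "complex set" where
  "resolvent_set = {\<mu>. \<forall>g\<in>wl2. \<exists>!f. f \<in> wl2 \<and> Lop p \<mu> f = g}"

lemma resolvent_set_iff_bij: "\<mu> \<in> resolvent_set \<longleftrightarrow> bij (L_ell2 \<mu>)"
proof -
  have range: "wl2 = range of_ell2"
    using of_ell2_in_wl2 of_to_ell2 by (auto simp: image_iff) metis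
  have "(\<exists>!f. f \<in> wl2 \<and> Q f) \<longleftrightarrow> (\<exists>!f. Q (of_ell2 f))" for Q
    unfolding range Ex1_def by (auto intro!: of_ell2_inject[THEN iffD1])
  then show ?thesis
    unfolding resolvent_set_def by (simp add: range bij_iff of_ell2_inject flip: of_ell2_L)
qed

definition R_ell2 :: "complex \<Rightarrow> ('v, complex) ell2 \<Rightarrow> ('v, complex) ell2" where
  "R_ell2 \<mu> = inv (L_ell2 \<mu>)"

lemma L_R_ell2: "\<mu> \<in> resolvent_set \<Longrightarrow> L_ell2 \<mu> (R_ell2 \<mu> f) = f"
  by (simp add: R_ell2_def resolvent_set_iff_bij bij_is_surj surj_f_inv_f)

lemma R_L_ell2: "\<mu> \<in> resolvent_set \<Longrightarrow> R_ell2 \<mu> (L_ell2 \<mu> f) = f"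
  by (simp add: R_ell2_def resolvent_set_iff_bij bij_is_inj)

lemma bounded_linear_R_ell2: "\<mu> \<in> resolvent_set \<Longrightarrow> bounded_linear (R_ell2 \<mu>)"
  by (simp add: R_ell2_def resolvent_set_iff_bij bounded_linear_inv bounded_linear_L_ell2)

lemma R_ell2_scaleC: "\<mu> \<in> resolvent_set \<Longrightarrow> R_ell2 \<mu> (scaleC_ell2 c f) = scaleC_ell2 c (R_ell2 \<mu> f)"
  by (metis L_R_ell2 R_L_ell2 L_ell2_scaleC)

definition resolvent :: "complex \<Rightarrow> ('v \<Rightarrow> complex) \<Rightarrow> 'v \<Rightarrow> complex" where
  "resolvent \<mu> g = of_ell2 (R_ell2 \<mu> (to_ell2 g))"

lemma resolvent_in_wl2: "resolvent \<mu> g \<in> wl2"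
  by (simp add: resolvent_def of_ell2_in_wl2)

lemma Lop_resolvent: "\<mu> \<in> resolvent_set \<Longrightarrow> g \<in> wl2 \<Longrightarrow> Lop p \<mu> (resolvent \<mu> g) = g"
  by (simp add: resolvent_def L_R_ell2 of_to_ell2 flip: of_ell2_L)

lemma resolvent_eqI:
  assumes "\<mu> \<in> resolvent_set" "f \<in> wl2" "Lop p \<mu> f = g"
  shows "resolvent \<mu> g = f"
proof -
  have "of_ell2 (L_ell2 \<mu> (to_ell2 f)) = g"
    using assms by (simp add: of_ell2_L of_to_ell2)
  then have "to_ell2 g = L_ell2 \<mu> (to_ell2 f)"
    using to_of_ell2 by metis
  then show ?thesis
    using assms(1,2) by (simp add: resolvent_def R_L_ell2 of_to_ell2)
qed

lemma L_ell2_eq_iff: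
  assumes reg: "\<mu>\<^sub>0 \<in> resolvent_set"
  shows "L_ell2 \<mu> f = g \<longleftrightarrow> f - scaleC_ell2 (\<mu>\<^sub>0 - \<mu>) (R_ell2 \<mu>\<^sub>0 f) = R_ell2 \<mu>\<^sub>0 g"
proof -
  have "L_ell2 \<mu> f = L_ell2 \<mu>\<^sub>0 f - scaleC_ell2 (\<mu>\<^sub>0 - \<mu>) f"
    by (rule ell2_eqI) (simp add: L_ell2_def apply_ell2_simps scaleC_ell2.rep_eq algebra_simps)
  then have "R_ell2 \<mu>\<^sub>0 (L_ell2 \<mu> f) = f - scaleC_ell2 (\<mu>\<^sub>0 - \<mu>) (R_ell2 \<mu>\<^sub>0 f)"
    by (simp add: linear_diff[OF bounded_linear.linear[OF bounded_linear_R_ell2[OF reg]]]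
        R_L_ell2 R_ell2_scaleC reg)
  moreover have "L_ell2 \<mu> f = g \<longleftrightarrow> R_ell2 \<mu>\<^sub>0 (L_ell2 \<mu> f) = R_ell2 \<mu>\<^sub>0 g"
    using L_R_ell2[OF reg] by metis
  ultimately show ?thesis
    by simp
qed

lemma
  assumes reg: "\<mu>\<^sub>0 \<in> resolvent_set" and small: "cmod (\<mu>\<^sub>0 - \<mu>) * onorm (R_ell2 \<mu>\<^sub>0) < 1"
  defines "t \<equiv> \<lambda>g k. scaleC_ell2 ((\<mu>\<^sub>0 - \<mu>) ^ k) ((R_ell2 \<mu>\<^sub>0 ^^ Suc k) g)"
  shows L_ell2_eq_iff_sums: "L_ell2 \<mu> f = g \<longleftrightarrow> t g sums f"
    and summable_resolvent_series: "summable (t g)"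
proof -
  define T where "T f = scaleC_ell2 (\<mu>\<^sub>0 - \<mu>) (R_ell2 \<mu>\<^sub>0 f)" for f
  note bounded_linear_R = bounded_linear_R_ell2[OF reg]
  have bounded_linear_T: "bounded_linear T"
    unfolding T_def by (rule bounded_linear_compose[OF bounded_linear_scaleC_ell2 bounded_linear_R])
  have onorm_T: "onorm T < 1"
  proof (rule le_less_trans[OF onorm_bound])
    show "norm (T f) \<le> (cmod (\<mu>\<^sub>0 - \<mu>) * onorm (R_ell2 \<mu>\<^sub>0)) * norm f" for f
      using mult_left_mono[OF onorm[OF bounded_linear_R, of f], of "cmod (\<mu>\<^sub>0 - \<mu>)"]
      by (simp add: T_def norm_scaleC_ell2 mult.assoc)
  qed (use small onorm_pos_le[OF bounded_linear_R] in simp_all)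
  have T_power: "(T ^^ k) (R_ell2 \<mu>\<^sub>0 g) = t g k" for k
    unfolding t_def
    by (induction k) (auto simp: T_def R_ell2_scaleC[OF reg] scaleC_ell2.rep_eq intro!: ell2_eqI)
  show "L_ell2 \<mu> f = g \<longleftrightarrow> t g sums f"
    using neumann_series_iff[OF bounded_linear_T onorm_T, of f "R_ell2 \<mu>\<^sub>0 g"]
    by (simp only: L_ell2_eq_iff[OF reg] T_power) (simp only: T_def)
  show "summable (t g)"
    using summable_funpow[OF bounded_linear_T onorm_T, of "R_ell2 \<mu>\<^sub>0 g"] by (simp only: T_power)
qed

lemma
  assumes reg: "\<mu>\<^sub>0 \<in> resolvent_set" and small: "cmod (\<mu>\<^sub>0 - \<mu>) * onorm (R_ell2 \<mu>\<^sub>0) < 1"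
  shows resolvent_set_near: "\<mu> \<in> resolvent_set"
    and resolvent_sums: "g \<in> wl2 \<Longrightarrow>
      (\<lambda>k. (\<mu>\<^sub>0 - \<mu>) ^ k * (resolvent \<mu>\<^sub>0 ^^ Suc k) g x) sums resolvent \<mu> g x"
proof -
  have "\<exists>!f. L_ell2 \<mu> f = h" for h
  proof -
    note series_sums = summable_sums[OF summable_resolvent_series[OF reg small, of h]]
    show ?thesis
      unfolding L_ell2_eq_iff_sums[OF reg small]
      by (rule ex1I, rule series_sums) (rule sums_unique2[OF _ series_sums])
  qed
  then show \<mu>: "\<mu> \<in> resolvent_set"
    by (simp add: resolvent_set_iff_bij bij_iff)
  assume g: "g \<in> wl2"
  have resolvent_power: "(resolvent \<mu>\<^sub>0 ^^ k) g = of_ell2 ((R_ell2 \<mu>\<^sub>0 ^^ k) (to_ell2 g))" for k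
    using g by (induction k) (simp_all add: resolvent_def to_of_ell2 of_to_ell2)
  note series_sums = L_R_ell2[OF \<mu>, of "to_ell2 g", unfolded L_ell2_eq_iff_sums[OF reg small]]
  show "(\<lambda>k. (\<mu>\<^sub>0 - \<mu>) ^ k * (resolvent \<mu>\<^sub>0 ^^ Suc k) g x) sums resolvent \<mu> g x"
    using sums_divide[OF bounded_linear.sums[OF bounded_linear_apply_ell2 series_sums],
        of x "of_real (sqrt (m x))"]
    unfolding resolvent_power by (simp add: resolvent_def of_ell2_def scaleC_ell2.rep_eq)
qed

theorem
  assumes reg: "\<mu> \<in> resolvent_set"
  shows eventually_resolvent_set: "eventually (\<lambda>t. \<mu> + t \<in> resolvent_set) (nhds 0)"
    and resolvent_expansion: "g \<in> wl2 \<Longrightarrow> eventually (\<lambda>t.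
      (\<lambda>k. (-1) ^ k * (resolvent \<mu> ^^ Suc k) g x * t ^ k) sums resolvent (\<mu> + t) g x) (nhds 0)"
proof -
  let ?N = "onorm (R_ell2 \<mu>)"
  have "((\<lambda>t. cmod t * ?N) \<longlongrightarrow> cmod 0 * ?N) (nhds 0)"
    by (intro tendsto_intros filterlim_ident)
  then have "eventually (\<lambda>t. cmod t * ?N < 1) (nhds 0)"
    by (rule order_tendstoD(2)) simp
  then have small: "eventually (\<lambda>t. cmod (\<mu> - (\<mu> + t)) * ?N < 1) (nhds 0)"
    by simp
  then show "eventually (\<lambda>t. \<mu> + t \<in> resolvent_set) (nhds 0)"
    by eventually_elim (rule resolvent_set_near[OF reg])
  assume g: "g \<in> wl2"
  have power: "(\<mu> - (\<mu> + t)) ^ k = (-1) ^ k * t ^ k" for t k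
    by (simp add: power_minus[of t])
  show "eventually (\<lambda>t.
      (\<lambda>k. (-1) ^ k * (resolvent \<mu> ^^ Suc k) g x * t ^ k) sums resolvent (\<mu> + t) g x) (nhds 0)"
    using small
  proof eventually_elim
    case (elim t)
    have "(\<lambda>k. (-1) ^ k * t ^ k * (resolvent \<mu> ^^ Suc k) g x) sums resolvent (\<mu> + t) g x"
      using resolvent_sums[OF reg elim g, of x] by (simp only: power)
    then show ?case
      by (simp only: mult.assoc mult.commute[of "t ^ _"])
  qed
qed

end

section \<open>Rooted trees and their ends\<close>

lemma is_walk_iff_successively: "is_walk adj xs \<longleftrightarrow> xs \<noteq> [] \<and> successively adj xs"
  by (simp add: is_walk_def successively_conv_nth)

locale rooted_tree =
  fixes adj :: "'v \<Rightarrow> 'v \<Rightarrow> bool" and rt :: 'v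
  assumes tree: "is_tree adj"
begin

abbreviation path :: "'v \<Rightarrow> 'v list" where "path \<equiv> geod adj rt"
abbreviation par :: "'v \<Rightarrow> 'v" where "par \<equiv> parent adj rt"
abbreviation kids :: "'v \<Rightarrow> 'v set" where "kids \<equiv> children adj rt"
abbreviation anc :: "'v \<Rightarrow> 'v set" where "anc x \<equiv> set (path x)"

lemma adj_sym: "adj x y \<Longrightarrow> adj y x"
  using tree unfolding is_tree_def by blast

lemma adj_irrefl: "\<not> adj x x"
  using tree unfolding is_tree_def by blast

lemma ex1_simple_path: "\<exists>!xs. is_simple_path adj x y xs"
  using tree unfolding is_tree_def by blast

lemma path_eqI: "is_simple_path adj rt x xs \<Longrightarrow> path x = xs"
  unfolding geod_def by (rule the1_equality[OF ex1_simple_path])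

lemma simple_path_path: "is_simple_path adj rt x (path x)"
  unfolding geod_def by (rule theI'[OF ex1_simple_path])

lemma path_nonempty [simp]: "path x \<noteq> []"
  and successively_path: "successively adj (path x)"
  and distinct_path: "distinct (path x)"
  and hd_path [simp]: "hd (path x) = rt"
  and last_path [simp]: "last (path x) = x"
  using simple_path_path[of x] by (auto simp: is_simple_path_def is_walk_iff_successively)

lemma path_inject: "path x = path y \<longleftrightarrow> x = y"
  using last_path by metis

lemma path_root: "path rt = [rt]"
  by (rule path_eqI) (simp add: is_simple_path_def is_walk_def)

lemma self_in_anc: "x \<in> anc x"
  using last_in_set[of "path x"] by simp

lemma root_in_anc: "rt \<in> anc x"
  using hd_in_set[of "path x"] by simp

lemma path_prefix:
  assumes "path x = as @ y # bs"
  shows "path y = as @ [y]"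
proof (rule path_eqI)
  have "successively adj ((as @ [y]) @ bs)" "distinct ((as @ [y]) @ bs)" "hd ((as @ [y]) @ bs) = rt"
    using successively_path[of x] distinct_path[of x] hd_path[of x] assms by auto
  then show "is_simple_path adj rt y (as @ [y])"
    unfolding is_simple_path_def is_walk_iff_successively successively_append_iff
    by (auto simp: hd_append)
qed

lemma path_splitE:
  assumes "z \<in> anc x"
  obtains bs where "path x = path z @ bs"
proof -
  obtain as bs where "path x = as @ z # bs"
    using assms by (meson split_list)
  then show thesis
    using that path_prefix by force
qed

lemma anc_trans: "u \<in> anc v \<Longrightarrow> v \<in> anc x \<Longrightarrow> u \<in> anc x"
  by (erule path_splitE[of v]) simp

lemma length_path_less:
  assumes "z \<in> anc x" "z \<noteq> x"
  shows "length (path z) < length (path x)"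
proof -
  obtain bs where bs: "path x = path z @ bs"
    using path_splitE[OF assms(1)] .
  then have "bs \<noteq> []"
    using assms(2) path_inject by auto
  then show ?thesis
    by (simp add: bs)
qed

lemma path_snoc:
  assumes "adj x y" "y \<notin> anc x"
  shows "path y = path x @ [y]"
  using successively_path[of x] distinct_path[of x] assms
  by (intro path_eqI)
    (auto simp: is_simple_path_def is_walk_iff_successively successively_append_iff)

lemma adj_path_cases:
  assumes "adj x y"
  shows "path y = path x @ [y] \<or> path x = path y @ [x]"
proof (cases "y \<in> anc x")
  case True
  have "x \<noteq> y"
    using assms adj_irrefl by blast
  then have "x \<notin> anc y"
    using True length_path_less[of y x] length_path_less[of x y] by auto
  then show ?thesis
    using path_snoc assms adj_sym by blast
qed (use assms path_snoc in blast)

lemma par_eqI: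
  assumes y: "path y = path x @ [y]"
  shows "par y = x"
  unfolding parent_def
proof (rule the_equality)
  show "adj x y \<and> x \<in> anc y"
    using successively_path[of y] self_in_anc[of x] y by (auto simp: successively_append_iff)
  show "z = x" if "adj z y \<and> z \<in> anc y" for z
  proof -
    have "path y = path z @ [y]"
      using that adj_path_cases[of z y] distinct_path[of z] by auto
    then show ?thesis
      using y path_inject by simp
  qed
qed

lemma path_par:
  assumes "y \<noteq> rt"
  shows "path y = path (par y) @ [y]"
proof -
  have snoc: "path y = butlast (path y) @ [y]"
    using append_butlast_last_id[of "path y"] by simp
  have "butlast (path y) \<noteq> []"
    using snoc hd_path[of y] assms by (metis append_Nil list.sel(1))
  then have "path y = butlast (butlast (path y)) @ last (butlast (path y)) # [y]"
    using snoc by (metis append.assoc append_Cons append_Nil append_butlast_last_id)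
  then have "path (last (butlast (path y))) = butlast (path y)"
    using path_prefix \<open>butlast (path y) \<noteq> []\<close> by (metis append_butlast_last_id)
  then show ?thesis
    using snoc par_eqI by metis
qed

lemma kids_iff: "y \<in> kids x \<longleftrightarrow> path y = path x @ [y]"
proof
  assume "y \<in> kids x"
  then show "path y = path x @ [y]"
    using path_par[of y] by (simp add: children_def)
next
  assume y: "path y = path x @ [y]"
  then have "y \<noteq> rt"
    using path_root by auto
  then show "y \<in> kids x"
    using par_eqI[OF y] by (simp add: children_def)
qed

lemma kids_par: "y \<noteq> rt \<Longrightarrow> y \<in> kids (par y)"
  by (simp add: children_def)

lemma anc_root: "anc rt = {rt}"
  by (simp add: path_root)

lemma anc_kid: "y \<in> kids x \<Longrightarrow> anc y = insert y (anc x)"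
  by (simp add: kids_iff)

lemma kid_not_anc: "y \<in> kids x \<Longrightarrow> y \<notin> anc x"
  using distinct_path[of y] by (auto simp: kids_iff)

lemma not_anc_par: "y \<noteq> rt \<Longrightarrow> y \<notin> anc (par y)"
  by (rule kid_not_anc[OF kids_par])

lemma par_in_anc: "z \<in> anc x \<Longrightarrow> z \<noteq> rt \<Longrightarrow> par z \<in> anc x"
  using anc_trans[of "par z" z x] anc_kid[OF kids_par, of z] self_in_anc[of "par z"] by auto

lemma anc_par_neq: "z \<in> anc x \<Longrightarrow> z \<noteq> rt \<Longrightarrow> par z \<noteq> x"
  using not_anc_par by blast

lemma adj_iff: "adj x y \<longleftrightarrow> y \<in> kids x \<or> x \<in> kids y"
proof
  have "adj x y" if "y \<in> kids x" for x y
    using that successively_path[of y] by (simp add: kids_iff successively_append_iff)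
  then show "adj x y" if "y \<in> kids x \<or> x \<in> kids y"
    using that adj_sym by blast
qed (auto simp: kids_iff dest: adj_path_cases)

lemma adj_leaving_branch:
  assumes "adj a b" "v \<in> anc a" "v \<notin> anc b"
  shows "v \<noteq> rt" "a = v" "b = par v"
proof -
  show "v \<noteq> rt"
    using assms root_in_anc by blast
  have "a \<in> kids b"
    using assms anc_kid by (auto simp: adj_iff)
  then show "a = v" "b = par v"
    using assms anc_kid[of a b] by (auto simp: children_def)
qed

lemma tree_induct [case_names root child]:
  assumes "P rt" "\<And>x y. y \<in> kids x \<Longrightarrow> P x \<Longrightarrow> P y"
  shows "P z"
proof (induction "length (path z)" arbitrary: z rule: less_induct)
  case less
  show ?case
  proof (cases "z = rt")
    case False
    then have "P (par z)"
      using path_par[of z] by (intro less) simp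
    then show ?thesis
      using assms(2) kids_par False by blast
  qed (simp add: assms)
qed

definition increment :: "('v \<Rightarrow> 'a::ab_group_add) \<Rightarrow> 'v \<Rightarrow> 'a" where
  "increment \<psi> z = \<psi> z - (if z = rt then 0 else \<psi> (par z))"

lemma sum_by_parts_anc:
  fixes \<psi> \<nu> :: "'v \<Rightarrow> 'a::comm_ring"
  shows "(\<Sum>z\<in>anc x. \<psi> z * (\<nu> z - (\<Sum>y\<in>anc x \<inter> kids z. \<nu> y))) = (\<Sum>z\<in>anc x. increment \<psi> z * \<nu> z)"
proof -
  have kids: "anc x \<inter> kids z = {y \<in> anc x - {rt}. par y = z}" for z
    by (auto simp: children_def)
  have "(\<Sum>z\<in>anc x. \<psi> z * (\<Sum>y\<in>anc x \<inter> kids z. \<nu> y))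
      = (\<Sum>z\<in>anc x. \<Sum>y | y \<in> anc x - {rt} \<and> par y = z. \<psi> (par y) * \<nu> y)"
    unfolding kids sum_distrib_left by (intro sum.cong) auto
  also have "\<dots> = (\<Sum>y\<in>anc x - {rt}. \<psi> (par y) * \<nu> y)"
    by (rule sum.group) (use par_in_anc in auto)
  also have "\<dots> = (\<Sum>z\<in>anc x. (if z = rt then 0 else \<psi> (par z)) * \<nu> z)"
    by (rule sum.mono_neutral_cong_left) auto
  finally show ?thesis
    by (simp add: increment_def right_diff_distrib left_diff_distrib sum_subtractf)
qed

lemma path_ray:
  assumes "\<xi> \<in> ends adj rt"
  shows "path (\<xi> n) = map \<xi> [0..<Suc n]"
proof (rule path_eqI)
  have "distinct (map \<xi> [0..<Suc n])"
    using assms by (simp add: ends_def distinct_map inj_on_subset[of \<xi> UNIV] del: upt_Suc)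
  moreover have "is_walk adj (map \<xi> [0..<Suc n])"
    using assms unfolding is_walk_def ends_def by (auto simp del: upt_Suc)
  ultimately show "is_simple_path adj rt (\<xi> n) (map \<xi> [0..<Suc n])"
    using assms unfolding is_simple_path_def ends_def by (auto simp: hd_map simp del: upt_Suc) simp
qed

lemma anc_ray: "\<xi> \<in> ends adj rt \<Longrightarrow> anc (\<xi> n) = \<xi> ` {..n}"
  by (simp add: path_ray atLeast0LessThan lessThan_Suc_atMost del: upt_Suc)

lemma ends_iff: "\<xi> \<in> ends adj rt \<longleftrightarrow> \<xi> 0 = rt \<and> (\<forall>n. \<xi> (Suc n) \<in> kids (\<xi> n))"
proof
  assume \<xi>: "\<xi> 0 = rt \<and> (\<forall>n. \<xi> (Suc n) \<in> kids (\<xi> n))"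
  have "length (path (\<xi> n)) = Suc n" for n
    using \<xi> by (induction n) (auto simp: path_root kids_iff)
  then have "inj \<xi>"
    by (metis Suc_inject injI)
  then show "\<xi> \<in> ends adj rt"
    using \<xi> by (auto simp: ends_def adj_iff)
next
  assume \<xi>: "\<xi> \<in> ends adj rt"
  then have "\<xi> (Suc n) \<in> kids (\<xi> n)" for n
    by (simp add: path_ray kids_iff)
  then show "\<xi> 0 = rt \<and> (\<forall>n. \<xi> (Suc n) \<in> kids (\<xi> n))"
    using \<xi> by (auto simp: ends_def)
qed

lemma splice_ends:
  assumes \<xi>: "\<xi> \<in> ends adj rt" and \<eta>: "\<eta> 0 \<in> kids (\<xi> k)" "\<And>n. \<eta> (Suc n) \<in> kids (\<eta> n)"
  shows "(\<lambda>n. if n \<le> k then \<xi> n else \<eta> (n - Suc k)) \<in> ends adj rt"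
proof -
  have "(if Suc n \<le> k then \<xi> (Suc n) else \<eta> (Suc n - Suc k))
      \<in> kids (if n \<le> k then \<xi> n else \<eta> (n - Suc k))" for n
  proof (cases n k rule: linorder_cases)
    case greater
    then have "Suc n - Suc k = Suc (n - Suc k)"
      by simp
    then show ?thesis
      using greater \<eta>(2) by simp
  qed (use \<xi> \<eta>(1) in \<open>simp_all add: ends_iff\<close>)
  then show ?thesis
    using \<xi> by (simp add: ends_iff)
qed

lemma bdy_kid_unique:
  assumes "\<xi> \<in> bdy adj rt y" "y \<in> kids x" "\<xi> k = x"
  shows "y = \<xi> (Suc k)"
proof -
  obtain j where j: "\<xi> \<in> ends adj rt" "\<xi> j = y"
    using assms by (auto simp: bdy_def)
  then have "length (path y) = Suc j" "length (path x) = Suc k"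
    using assms path_ray[OF j(1), of j] path_ray[OF j(1), of k] by auto
  then show ?thesis
    using assms j by (auto simp: kids_iff)
qed

lemma bdy_kid_subset:
  assumes "y \<in> kids x"
  shows "bdy adj rt y \<subseteq> bdy adj rt x"
proof
  fix \<xi>
  assume "\<xi> \<in> bdy adj rt y"
  then obtain j where j: "\<xi> \<in> ends adj rt" "\<xi> j = y"
    by (auto simp: bdy_def)
  then have "x \<in> \<xi> ` {..j}"
    using anc_ray[of \<xi> j] anc_kid[OF assms] self_in_anc[of x] by auto
  then show "\<xi> \<in> bdy adj rt x"
    using j by (auto simp: bdy_def)
qed

definition offshoot :: "'v \<Rightarrow> 'v \<Rightarrow> (nat \<Rightarrow> 'v) set" where
  "offshoot x z = bdy adj rt z - (\<Union>y\<in>anc x \<inter> kids z. bdy adj rt y)"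

lemma confl_offshoot:
  assumes z: "z \<in> anc x" and \<xi>: "\<xi> \<in> offshoot x z"
  shows "confl adj rt x \<xi> = z"
proof -
  obtain k where k: "\<xi> \<in> ends adj rt" "\<xi> k = z"
    using \<xi> by (auto simp: offshoot_def bdy_def)
  have "(GREATEST j. \<xi> j \<in> anc x) = k"
  proof (rule Greatest_equality)
    show "\<xi> k \<in> anc x"
      using k z by simp
    fix j
    assume j: "\<xi> j \<in> anc x"
    show "j \<le> k"
    proof (rule ccontr)
      assume "\<not> j \<le> k"
      then have "\<xi> (Suc k) \<in> anc (\<xi> j)"
        using anc_ray[OF k(1)] by auto
      then have "\<xi> (Suc k) \<in> anc x"
        using anc_trans[OF _ j] by blast
      moreover have "\<xi> (Suc k) \<in> kids z"
        using k ends_iff by blast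
      ultimately show False
        using \<xi> k(1) by (auto simp: offshoot_def bdy_def)
    qed
  qed
  then show ?thesis
    using k by (simp add: confl_def)
qed

end

lemma cdist_iff: "cdist adj rt \<nu> \<longleftrightarrow> (\<forall>x. (\<nu> has_sum \<nu> x) (children adj rt x))"
  unfolding cdist_def summable_on_iff_abs_summable_on_complex[symmetric]
  using has_sum_imp_summable by blast

lemma cdist_zero: "cdist adj rt (\<lambda>_. 0)"
  by (simp add: cdist_iff)

lemma cdist_cmult: "cdist adj rt \<nu> \<Longrightarrow> cdist adj rt (\<lambda>x. a * \<nu> x)"
  unfolding cdist_iff by (intro allI has_sum_cmult_right) simp

locale leafless_tree = rooted_tree +
  assumes no_leaves: "no_leaves adj"
begin

lemma kids_nonempty: "\<exists>y. y \<in> kids x"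
proof -
  obtain y z where "adj x y" "adj x z" "y \<noteq> z"
    using no_leaves unfolding no_leaves_def by blast
  then have "y \<in> kids x \<or> z \<in> kids x"
    by (auto simp: adj_iff children_def)
  then show ?thesis
    by blast
qed

lemma bdy_nonempty: "bdy adj rt z \<noteq> {}"
proof -
  obtain s where s: "\<And>x. s x \<in> kids x"
    using kids_nonempty by metis
  have "\<exists>\<xi> k. \<xi> \<in> ends adj rt \<and> \<xi> k = z"
  proof (induction z rule: tree_induct)
    case root
    show ?case
      using s by (intro exI[of _ "\<lambda>n. (s ^^ n) rt"] exI[of _ 0]) (auto simp: ends_iff)
  next
    case (child x y)
    then obtain \<xi> k where \<xi>: "\<xi> \<in> ends adj rt" "\<xi> k = x"
      by blast
    have "(\<lambda>n. if n \<le> k then \<xi> n else (s ^^ (n - Suc k)) y) \<in> ends adj rt"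
      using splice_ends[OF \<xi>(1), of "\<lambda>n. (s ^^ n) y" k] \<xi>(2) child(1) s by simp
    then show ?case
      by (intro exI[of _ "\<lambda>n. if n \<le> k then \<xi> n else (s ^^ (n - Suc k)) y"] exI[of _ "Suc k"]) simp
  qed
  then show ?thesis
    by (auto simp: bdy_def)
qed

lemma cdist_weight_zero_if_offshoot_empty:
  assumes \<nu>: "cdist adj rt \<nu>" and empty: "offshoot x z = {}"
  shows "\<nu> z - (\<Sum>y\<in>anc x \<inter> kids z. \<nu> y) = 0"
proof -
  have "kids z \<subseteq> anc x"
  proof
    fix y
    assume y: "y \<in> kids z"
    obtain \<xi> where \<xi>: "\<xi> \<in> bdy adj rt y"
      using bdy_nonempty by blast
    then have "\<xi> \<in> bdy adj rt z"
      using bdy_kid_subset[OF y] by blast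
    then obtain y' where y': "y' \<in> anc x \<inter> kids z" "\<xi> \<in> bdy adj rt y'"
      using empty by (auto simp: offshoot_def)
    obtain k where "\<xi> k = z"
      using \<open>\<xi> \<in> bdy adj rt z\<close> by (auto simp: bdy_def)
    then show "y \<in> anc x"
      using bdy_kid_unique[OF \<xi> y] bdy_kid_unique[of \<xi> y' z k] y' by auto
  qed
  then have "anc x \<inter> kids z = kids z" "finite (kids z)"
    using finite_subset[of "kids z" "anc x"] by auto
  then show ?thesis
    using \<nu> has_sum_finite_iff[of "kids z" \<nu> "\<nu> z"] by (simp add: cdist_iff)
qed

lemma loc_integral_confl:
  assumes \<nu>: "cdist adj rt \<nu>" and \<phi>: "\<And>\<xi>. \<phi> \<xi> = \<psi> (confl adj rt x \<xi>)"
  shows "loc_integral adj rt (anc x) \<phi> \<nu> = (\<Sum>z\<in>anc x. increment \<psi> z * \<nu> z)"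
  unfolding loc_integral_def sum_by_parts_anc[symmetric] offshoot_def[symmetric]
proof (rule sum.cong)
  fix z
  assume z: "z \<in> anc x"
  show "\<phi> (SOME \<xi>. \<xi> \<in> offshoot x z) * (\<nu> z - (\<Sum>y\<in>anc x \<inter> kids z. \<nu> y))
      = \<psi> z * (\<nu> z - (\<Sum>y\<in>anc x \<inter> kids z. \<nu> y))"
  proof (cases "offshoot x z = {}")
    case True
    then show ?thesis
      using cdist_weight_zero_if_offshoot_empty[OF \<nu>] by simp
  next
    case False
    then have "(SOME \<xi>. \<xi> \<in> offshoot x z) \<in> offshoot x z"
      by (rule some_in_eq[THEN iffD2])
    then show ?thesis
      using confl_offshoot[OF z] \<phi> by simp
  qed
qed simp

end

section \<open>Triangular representation of polyharmonic functions\<close>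

lemma has_sum_sum:
  fixes f :: "'i \<Rightarrow> 'a \<Rightarrow> 'b::topological_comm_monoid_add"
  assumes "\<And>i. i \<in> I \<Longrightarrow> (f i has_sum s i) A"
  shows "((\<lambda>x. \<Sum>i\<in>I. f i x) has_sum (\<Sum>i\<in>I. s i)) A"
  using assms by (induction I rule: infinite_finite_induct) (auto intro: has_sum_add)

lemma has_sum_if_iff: "((\<lambda>x. if x \<in> A then f x else 0) has_sum s) UNIV \<longleftrightarrow> (f has_sum s) A"
  by (rule has_sum_cong_neutral) auto

lemma polyharmonic_0: "polyharmonic p lam 0 f \<longleftrightarrow> f = (\<lambda>_. 0)"
  by (simp add: polyharmonic_def)

lemma polyharmonic_Suc:
  "polyharmonic p lam (Suc n) f \<longleftrightarrow> Pdefined p f \<and> polyharmonic p lam n (Lop p lam f)"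
  unfolding polyharmonic_def by (simp add: All_less_Suc2 funpow_swap1)

text \<open>In the application, \<open>kernel r v\<close> and \<open>charge r v\<close> are the \<open>r\<close>-th Taylor coefficients at \<open>lam\<close>
  of \<open>G(\<cdot>, v) / G(rt, v)\<close> and \<open>1 / G(rt, v)\<close> as functions of the spectral parameter.\<close>

locale kernel_tree = rooted_tree adj rt for adj :: "'v \<Rightarrow> 'v \<Rightarrow> bool" and rt +
  fixes p :: "'v \<Rightarrow> 'v \<Rightarrow> real" and lam :: complex
    and kernel :: "nat \<Rightarrow> 'v \<Rightarrow> 'v \<Rightarrow> complex" and charge :: "nat \<Rightarrow> 'v \<Rightarrow> complex"
  assumes p_neq_0_iff: "p x y \<noteq> 0 \<longleftrightarrow> adj x y"
    and kernel_outside_branch: "v \<noteq> rt \<Longrightarrow> v \<notin> anc x \<Longrightarrow> kernel r v x = kernel r (par v) x"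
    and Pdefined_kernel: "Pdefined p (kernel r v)"
    and Lop_kernel: "Lop p lam (kernel r v) x
        = (if x = v then charge r v else 0) - (if r = 0 then 0 else kernel (r - 1) v x)"
    and charge_0_nonzero: "charge 0 v \<noteq> 0"
    and kernel_root_nonzero: "kernel 0 rt rt \<noteq> 0"
begin

definition kernel_incr :: "nat \<Rightarrow> 'v \<Rightarrow> 'v \<Rightarrow> complex" where
  "kernel_incr r v x = increment (\<lambda>v. kernel r v x) v"

definition kernel_integral :: "nat \<Rightarrow> ('v \<Rightarrow> complex) \<Rightarrow> 'v \<Rightarrow> complex" where
  "kernel_integral r \<nu> x = (\<Sum>v\<in>anc x. kernel_incr r v x * \<nu> v)"

lemma kernel_incr_root: "kernel_incr r rt = kernel r rt"
  by (simp add: kernel_incr_def increment_def fun_eq_iff)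

lemma kernel_incr_nonroot: "v \<noteq> rt \<Longrightarrow> kernel_incr r v = (\<lambda>x. kernel r v x - kernel r (par v) x)"
  by (simp add: kernel_incr_def increment_def fun_eq_iff)

lemma kernel_incr_outside_branch: "v \<notin> anc x \<Longrightarrow> kernel_incr r v x = 0"
  using kernel_outside_branch[of v x r] root_in_anc
  by (cases "v = rt") (auto simp: kernel_incr_nonroot)

lemma Pdefined_kernel_incr: "Pdefined p (kernel_incr r v)"
  by (cases "v = rt")
    (simp_all add: kernel_incr_root kernel_incr_nonroot Pdefined_kernel Pdefined_diff)

lemma Lop_kernel_incr:
  "Lop p lam (kernel_incr r v) x =
    (if x = v then charge r v else 0) - (if v \<noteq> rt \<and> x = par v then charge r x else 0)
    - (if r = 0 then 0 else kernel_incr (r - 1) v x)"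
  by (cases "v = rt")
    (simp_all add: kernel_incr_root kernel_incr_nonroot Lop_kernel Lop_diff Pdefined_kernel)

lemma kernel_incr_diagonal:
  assumes y: "y \<in> kids x"
  shows "complex_of_real (p x y) * kernel_incr r y y = charge r x"
proof -
  have notin: "y \<notin> anc x"
    by (rule kid_not_anc[OF y])
  have "Lop p lam (kernel_incr r y) x = - charge r x"
    using y notin self_in_anc[of x]
    by (auto simp: Lop_kernel_incr kernel_incr_outside_branch children_def)
  moreover have "Pop p (kernel_incr r y) x = complex_of_real (p x y) * kernel_incr r y y"
  proof (rule Pop_eqI)
    have "complex_of_real (p x z) * kernel_incr r y z = 0" if "z \<noteq> y" for z
    proof (rule ccontr)
      assume "complex_of_real (p x z) * kernel_incr r y z \<noteq> 0"
      then have "adj z x" "y \<in> anc z"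
        using p_neq_0_iff[of x z] kernel_incr_outside_branch[of y z r] adj_sym by auto
      then show False
        using adj_leaving_branch(2) notin that by blast
    qed
    then show "((\<lambda>z. complex_of_real (p x z) * kernel_incr r y z)
        has_sum complex_of_real (p x y) * kernel_incr r y y) UNIV"
      by (intro has_sum_finite_neutralI[of "{y}"]) auto
  qed
  ultimately show ?thesis
    using notin by (simp add: Lop_def kernel_incr_outside_branch)
qed

lemma kernel_incr_diagonal_nonzero: "kernel_incr 0 v v \<noteq> 0"
proof (cases "v = rt")
  case True
  then show ?thesis
    by (simp add: kernel_incr_root kernel_root_nonzero)
next
  case False
  then show ?thesis
    using kernel_incr_diagonal[OF kids_par[OF False], of 0] charge_0_nonzero[of "par v"] by auto
qed

lemma p_kernel_integral:
  "complex_of_real (p x y) * kernel_integral r \<nu> y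
    = (\<Sum>v\<in>anc x. \<nu> v * (complex_of_real (p x y) * kernel_incr r v y))
      + (if y \<in> kids x then charge r x * \<nu> y else 0)"
proof -
  have integral_terms: "complex_of_real (p x y) * kernel_integral r \<nu> y
      = (\<Sum>v\<in>anc y. \<nu> v * (complex_of_real (p x y) * kernel_incr r v y))"
    by (simp add: kernel_integral_def sum_distrib_left mult_ac)
  consider (child) "y \<in> kids x" | (parent) "x \<in> kids y" | (nonadjacent) "\<not> adj x y"
    using adj_iff by blast
  then show ?thesis
  proof cases
    case child
    then show ?thesis
      unfolding integral_terms
      by (simp add: anc_kid[OF child] kid_not_anc[OF child] kernel_incr_diagonal mult.commute)
  next
    case parent
    then have "y \<notin> kids x"
      using anc_kid kid_not_anc self_in_anc by blast
    then show ?thesis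
      unfolding integral_terms using kid_not_anc[OF parent]
      by (simp add: anc_kid[OF parent] kernel_incr_outside_branch)
  next
    case nonadjacent
    then show ?thesis
      using p_neq_0_iff[of x y] adj_iff[of x y] by auto
  qed
qed

lemma has_sum_Pop_kernel_incr:
  "((\<lambda>y. \<Sum>v\<in>anc x. \<nu> v * (complex_of_real (p x y) * kernel_incr r v y))
    has_sum (\<Sum>v\<in>anc x. \<nu> v * Pop p (kernel_incr r v) x)) UNIV"
  by (intro has_sum_sum has_sum_cmult_right has_sum_Pop Pdefined_kernel_incr)

lemma sum_Pop_kernel_incr:
  "(\<Sum>v\<in>anc x. \<nu> v * Pop p (kernel_incr r v) x)
    = lam * kernel_integral r \<nu> x - charge r x * \<nu> x
      + (if r = 0 then 0 else kernel_integral (r - 1) \<nu> x)"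
proof -
  have "\<nu> v * Pop p (kernel_incr r v) x
      = lam * (kernel_incr r v x * \<nu> v) - (if v = x then charge r x * \<nu> x else 0)
      + (if r = 0 then 0 else kernel_incr (r - 1) v x * \<nu> v)" if "v \<in> anc x" for v
  proof -
    have "\<not> (v \<noteq> rt \<and> x = par v)"
      using anc_par_neq[OF that] by blast
    then have "Lop p lam (kernel_incr r v) x
        = (if x = v then charge r v else 0) - (if r = 0 then 0 else kernel_incr (r - 1) v x)"
      by (simp only: Lop_kernel_incr if_False diff_zero)
    then have Pop_kernel_incr: "Pop p (kernel_incr r v) x
        = lam * kernel_incr r v x - (if x = v then charge r v else 0)
        + (if r = 0 then 0 else kernel_incr (r - 1) v x)"
      by (simp add: Lop_def algebra_simps)
    show ?thesis
      unfolding Pop_kernel_incr by (auto simp: algebra_simps)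
  qed
  then have "(\<Sum>v\<in>anc x. \<nu> v * Pop p (kernel_incr r v) x)
      = (\<Sum>v\<in>anc x. lam * (kernel_incr r v x * \<nu> v)
      - (if v = x then charge r x * \<nu> x else 0)
      + (if r = 0 then 0 else kernel_incr (r - 1) v x * \<nu> v))"
    by (rule sum.cong[OF refl])
  then show ?thesis
    using self_in_anc[of x]
    by (simp add: sum.distrib sum_subtractf kernel_integral_def sum_distrib_left)
qed

lemma
  assumes "cdist adj rt \<nu>"
  shows Pdefined_kernel_integral: "Pdefined p (kernel_integral r \<nu>)"
    and Lop_kernel_integral: "Lop p lam (kernel_integral r \<nu>) x
        = (if r = 0 then 0 else - kernel_integral (r - 1) \<nu> x)"
proof -
  have has_sum_p: "((\<lambda>y. complex_of_real (p x y) * kernel_integral r \<nu> y)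
      has_sum (\<Sum>v\<in>anc x. \<nu> v * Pop p (kernel_incr r v) x) + charge r x * \<nu> x) UNIV" for x
    unfolding p_kernel_integral using assms
    by (intro has_sum_add has_sum_Pop_kernel_incr has_sum_if_iff[THEN iffD2] has_sum_cmult_right)
      (simp add: cdist_iff)
  then show "Pdefined p (kernel_integral r \<nu>)"
    using has_sum_imp_summable by (auto simp: Pdefined_iff)
  show "Lop p lam (kernel_integral r \<nu>) x = (if r = 0 then 0 else - kernel_integral (r - 1) \<nu> x)"
    using Pop_eqI[OF has_sum_p] by (simp add: Lop_def sum_Pop_kernel_incr)
qed

lemma cdist_if_kernel_integral_0_harmonic:
  assumes defined: "Pdefined p (kernel_integral 0 \<nu>)"
    and harmonic: "\<And>x. Lop p lam (kernel_integral 0 \<nu>) x = 0"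
  shows "cdist adj rt \<nu>"
  unfolding cdist_iff
proof
  fix x
  let ?S = "\<Sum>v\<in>anc x. \<nu> v * Pop p (kernel_incr 0 v) x"
  have "((\<lambda>y. complex_of_real (p x y) * kernel_integral 0 \<nu> y
      + -1 * (\<Sum>v\<in>anc x. \<nu> v * (complex_of_real (p x y) * kernel_incr 0 v y)))
      has_sum (Pop p (kernel_integral 0 \<nu>) x + -1 * ?S)) UNIV"
    by (intro has_sum_add has_sum_cmult_right has_sum_Pop defined has_sum_Pop_kernel_incr)
  moreover have "Pop p (kernel_integral 0 \<nu>) x + -1 * ?S = charge 0 x * \<nu> x"
    using harmonic[of x] by (simp add: sum_Pop_kernel_incr Lop_def)
  ultimately have "((\<lambda>y. charge 0 x * \<nu> y) has_sum (charge 0 x * \<nu> x)) (kids x)"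
    by (simp add: p_kernel_integral has_sum_if_iff)
  then show "(\<nu> has_sum \<nu> x) (kids x)"
    using charge_0_nonzero by (simp add: has_sum_cmult_right_iff)
qed

lemma kernel_integral_0_surj: "\<exists>\<nu>. kernel_integral 0 \<nu> = f"
proof -
  let ?P = "\<lambda>\<nu> x a. (\<Sum>v\<in>anc x - {x}. kernel_incr 0 v x * \<nu> v) + kernel_incr 0 x x * a = f x"
  have "\<exists>\<nu>. \<forall>x. ?P \<nu> x (\<nu> x)"
  proof (rule dependent_wf_choice[of "Wellfounded.measure (\<lambda>x. length (path x))"])
    show "?P \<nu> x a = ?P \<mu> x a"
      if "\<And>v. (v, x) \<in> Wellfounded.measure (\<lambda>x. length (path x)) \<Longrightarrow> \<nu> v = \<mu> v" for \<nu> \<mu> x a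
    proof -
      have "(\<Sum>v\<in>anc x - {x}. kernel_incr 0 v x * \<nu> v) = (\<Sum>v\<in>anc x - {x}. kernel_incr 0 v x * \<mu> v)"
        using that length_path_less by (intro sum.cong) auto
      then show ?thesis
        by simp
    qed
    show "\<exists>a. ?P \<nu> x a" for \<nu> x
      using kernel_incr_diagonal_nonzero[of x]
      by (intro exI[of _ "(f x - (\<Sum>v\<in>anc x - {x}. kernel_incr 0 v x * \<nu> v)) / kernel_incr 0 x x"])
        simp
  qed simp
  moreover have "kernel_integral 0 \<nu> x
      = (\<Sum>v\<in>anc x - {x}. kernel_incr 0 v x * \<nu> v) + kernel_incr 0 x x * \<nu> x" for \<nu> x
    unfolding kernel_integral_def by (subst sum.remove[of "anc x" x]) (auto simp: self_in_anc)
  ultimately show ?thesis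
    by (simp add: fun_eq_iff)
qed

lemma kernel_integral_0_inj:
  assumes "kernel_integral 0 \<nu> = kernel_integral 0 \<mu>"
  shows "\<nu> = \<mu>"
proof
  have "\<forall>v\<in>anc x. \<nu> v = \<mu> v" for x
  proof (induction x rule: tree_induct)
    case root
    then show ?case
      using fun_cong[OF assms, of rt] kernel_incr_diagonal_nonzero[of rt]
      by (simp add: kernel_integral_def anc_root)
  next
    case (child x y)
    then have "\<nu> y = \<mu> y"
      using fun_cong[OF assms, of y] kernel_incr_diagonal_nonzero[of y] kid_not_anc[of y x]
      by (simp add: kernel_integral_def anc_kid[of y x])
    then show ?case
      using child by (simp add: anc_kid)
  qed
  then show "\<nu> x = \<mu> x" for x
    using self_in_anc by blast
qed

definition kernel_integral_sum :: "nat \<Rightarrow> (nat \<Rightarrow> 'v \<Rightarrow> complex) \<Rightarrow> 'v \<Rightarrow> complex" where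
  "kernel_integral_sum n \<nu> x = (\<Sum>r<n. kernel_integral r (\<nu> r) x)"

lemma kernel_integral_sum_0: "kernel_integral_sum 0 \<nu> = (\<lambda>_. 0)"
  by (simp add: kernel_integral_sum_def fun_eq_iff)

lemma kernel_integral_sum_Suc:
  "kernel_integral_sum (Suc n) \<nu> x
    = kernel_integral 0 (\<nu> 0) x + (\<Sum>r<n. kernel_integral (Suc r) (\<nu> (Suc r)) x)"
  unfolding kernel_integral_sum_def by (rule sum.lessThan_Suc_shift)

lemma kernel_integral_uminus: "kernel_integral r (\<lambda>v. - \<nu> v) x = - kernel_integral r \<nu> x"
  by (simp add: kernel_integral_def sum_negf)

lemma Pdefined_kernel_integral_sum:
  "(\<And>r. r < n \<Longrightarrow> cdist adj rt (\<nu> r)) \<Longrightarrow> Pdefined p (kernel_integral_sum n \<nu>)"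
  unfolding kernel_integral_sum_def by (intro Pdefined_sum Pdefined_kernel_integral) auto

lemma Lop_kernel_integral_sum:
  assumes "\<And>r. r < Suc n \<Longrightarrow> cdist adj rt (\<nu> r)"
  shows "Lop p lam (kernel_integral_sum (Suc n) \<nu>) = kernel_integral_sum n (\<lambda>r x. - \<nu> (Suc r) x)"
proof
  fix x
  have "Lop p lam (kernel_integral_sum (Suc n) \<nu>) x
      = (\<Sum>r<Suc n. Lop p lam (kernel_integral r (\<nu> r)) x)"
    unfolding kernel_integral_sum_def using assms by (intro Lop_sum Pdefined_kernel_integral) auto
  also have "\<dots> = (\<Sum>r<Suc n. if r = 0 then 0 else - kernel_integral (r - 1) (\<nu> r) x)"
    using assms by (intro sum.cong Lop_kernel_integral) auto
  also have "\<dots> = kernel_integral_sum n (\<lambda>r x. - \<nu> (Suc r) x) x"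
    unfolding sum.lessThan_Suc_shift by (simp add: kernel_integral_sum_def kernel_integral_uminus)
  finally show "Lop p lam (kernel_integral_sum (Suc n) \<nu>) x
      = kernel_integral_sum n (\<lambda>r x. - \<nu> (Suc r) x) x" .
qed

lemma cdist_uminus: "cdist adj rt \<nu> \<Longrightarrow> cdist adj rt (\<lambda>x. - \<nu> x)"
  using cdist_cmult[of adj rt \<nu> "-1"] by simp

lemma polyharmonic_kernel_integral_sum:
  "(\<And>r. r < n \<Longrightarrow> cdist adj rt (\<nu> r)) \<Longrightarrow> polyharmonic p lam n (kernel_integral_sum n \<nu>)"
proof (induction n arbitrary: \<nu>)
  case 0
  then show ?case
    by (simp add: polyharmonic_0 kernel_integral_sum_0)
next
  case (Suc n)
  then have "polyharmonic p lam n (kernel_integral_sum n (\<lambda>r x. - \<nu> (Suc r) x))"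
    by (auto intro!: Suc.IH cdist_uminus)
  then show ?case
    using Suc.prems
    by (simp add: polyharmonic_Suc Pdefined_kernel_integral_sum Lop_kernel_integral_sum)
qed

lemma polyharmonic_imp_kernel_integral_sum:
  "polyharmonic p lam n f \<Longrightarrow> \<exists>\<nu>. (\<forall>r<n. cdist adj rt (\<nu> r)) \<and> f = kernel_integral_sum n \<nu>"
proof (induction n arbitrary: f)
  case 0
  then show ?case
    by (simp add: polyharmonic_0 kernel_integral_sum_0)
next
  case (Suc n)
  then have f: "Pdefined p f" "polyharmonic p lam n (Lop p lam f)"
    by (auto simp: polyharmonic_Suc)
  then obtain \<nu> where \<nu>: "\<forall>r<n. cdist adj rt (\<nu> r)" "Lop p lam f = kernel_integral_sum n \<nu>"
    using Suc.IH by blast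
  define \<mu> where "\<mu> r = (if r = 0 then (\<lambda>_. 0) else (\<lambda>x. - \<nu> (r - 1) x))" for r
  have \<mu>: "cdist adj rt (\<mu> r)" if "r < Suc n" for r
    using \<nu>(1) that by (auto simp: \<mu>_def cdist_zero cdist_uminus)
  have Lop_\<mu>: "Lop p lam (kernel_integral_sum (Suc n) \<mu>) = Lop p lam f"
    by (simp add: Lop_kernel_integral_sum \<mu> \<nu>(2)) (simp add: \<mu>_def)
  obtain \<kappa> where \<kappa>: "kernel_integral 0 \<kappa> = (\<lambda>x. f x - kernel_integral_sum (Suc n) \<mu> x)"
    using kernel_integral_0_surj by blast
  have "Pdefined p (kernel_integral 0 \<kappa>)" "Lop p lam (kernel_integral 0 \<kappa>) x = 0" for x
    unfolding \<kappa> by (simp_all add: Pdefined_diff Lop_diff f(1) Pdefined_kernel_integral_sum \<mu> Lop_\<mu>)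
  then have "cdist adj rt \<kappa>"
    by (rule cdist_if_kernel_integral_0_harmonic)
  then have "cdist adj rt ((\<mu>(0 := \<kappa>)) r)" if "r < Suc n" for r
    using \<mu>[OF that] by simp
  moreover have "f x = kernel_integral_sum (Suc n) (\<mu>(0 := \<kappa>)) x" for x
    using fun_cong[OF \<kappa>, of x]
    by (simp add: kernel_integral_sum_Suc) (simp add: \<mu>_def kernel_integral_def)
  ultimately show ?case
    by blast
qed

lemma kernel_integral_sum_inj:
  "(\<And>r. r < n \<Longrightarrow> cdist adj rt (\<nu> r)) \<Longrightarrow> (\<And>r. r < n \<Longrightarrow> cdist adj rt (\<mu> r)) \<Longrightarrow>
    kernel_integral_sum n \<nu> = kernel_integral_sum n \<mu> \<Longrightarrow> r < n \<Longrightarrow> \<nu> r = \<mu> r"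
proof (induction n arbitrary: \<nu> \<mu> r)
  case (Suc n)
  have Lop_eq: "kernel_integral_sum n (\<lambda>r x. - \<nu> (Suc r) x)
      = kernel_integral_sum n (\<lambda>r x. - \<mu> (Suc r) x)"
    using arg_cong[OF Suc.prems(3), of "Lop p lam"]
    by (simp only: Lop_kernel_integral_sum[OF Suc.prems(1)]
        Lop_kernel_integral_sum[OF Suc.prems(2)])
  have "(\<lambda>x. - \<nu> (Suc r) x) = (\<lambda>x. - \<mu> (Suc r) x)" if "r < n" for r
    by (rule Suc.IH[OF _ _ Lop_eq that]) (auto intro!: cdist_uminus Suc.prems(1,2))
  then have tail: "\<nu> (Suc r) = \<mu> (Suc r)" if "r < n" for r
    using that by (auto simp: fun_eq_iff)
  have "kernel_integral 0 (\<nu> 0) = kernel_integral 0 (\<mu> 0)"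
  proof
    show "kernel_integral 0 (\<nu> 0) x = kernel_integral 0 (\<mu> 0) x" for x
      using fun_cong[OF Suc.prems(3), of x] tail by (simp add: kernel_integral_sum_Suc)
  qed
  then have "\<nu> 0 = \<mu> 0"
    by (rule kernel_integral_0_inj)
  then show ?case
    using tail Suc.prems(4) by (cases r) auto
qed simp

end

section \<open>Green functions on trees\<close>

lemma zip_tl_snoc: "xs \<noteq> [] \<Longrightarrow> zip (xs @ [y]) (tl xs @ [y]) = zip xs (tl xs) @ [(last xs, y)]"
proof (induction xs)
  case (Cons x xs)
  then show ?case
    by (cases xs) auto
qed simp

locale tree_walk = rooted_tree adj rt for adj :: "'v \<Rightarrow> 'v \<Rightarrow> bool" and rt +
  fixes p :: "'v \<Rightarrow> 'v \<Rightarrow> real"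
  assumes stochastic: "stochastic adj p"
begin

lemma p_pos_iff: "p x y > 0 \<longleftrightarrow> adj x y"
  using stochastic by (simp add: stochastic_def)

lemma p_eq_0: "\<not> adj x y \<Longrightarrow> p x y = 0"
  using stochastic p_pos_iff[of x y] unfolding stochastic_def by (metis less_eq_real_def)

lemma mfun_kid: "y \<in> kids x \<Longrightarrow> mfun adj p rt y = mfun adj p rt x * (p x y / p y x)"
  by (simp add: mfun_def Let_def kids_iff zip_tl_snoc)

lemma mfun_pos: "mfun adj p rt x > 0"
proof (induction x rule: tree_induct)
  case root
  then show ?case
    by (simp add: mfun_def path_root)
next
  case (child x y)
  then have "p x y > 0" "p y x > 0"
    by (auto simp: p_pos_iff adj_iff)
  then show ?case
    using child by (simp add: mfun_kid)
qed

lemma mfun_reversible: "mfun adj p rt x * p x y = mfun adj p rt y * p y x"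
proof -
  have reversible_kid: "mfun adj p rt x * p x y = mfun adj p rt y * p y x" if "y \<in> kids x" for x y
  proof -
    have "p y x > 0"
      using that by (simp add: p_pos_iff adj_iff)
    then show ?thesis
      by (simp add: mfun_kid[OF that])
  qed
  consider "y \<in> kids x" | "x \<in> kids y" | "\<not> adj x y" "\<not> adj y x"
    using adj_iff by blast
  then show ?thesis
    by cases (auto simp: p_eq_0 dest: reversible_kid)
qed

sublocale invariant_kernel p "mfun adj p rt"
proof
  show total_mass: "(p x has_sum 1) UNIV" for x
    using stochastic by (simp add: stochastic_def)
  show "((\<lambda>x. mfun adj p rt x * p x y) has_sum mfun adj p rt y) UNIV" for y
    unfolding mfun_reversible[of _ y] using has_sum_cmult_right[OF total_mass] by fastforce
qed (use stochastic mfun_pos in \<open>simp_all add: stochastic_def\<close>)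

abbreviation unit :: "'v \<Rightarrow> 'v \<Rightarrow> complex" where
  "unit y \<equiv> \<lambda>x. if x = y then 1 else 0"

abbreviation G :: "complex \<Rightarrow> 'v \<Rightarrow> 'v \<Rightarrow> complex" where
  "G \<equiv> green adj p rt"

lemma l2m_eq_wl2: "l2m adj p rt = wl2"
  by (simp add: l2m_def wl2_def)

lemma resP_eq_resolvent_set: "resP adj p rt = resolvent_set"
  by (simp add: resP_def resolvent_set_def l2m_eq_wl2)

lemma green_eq_resolvent:
  assumes "\<mu> \<in> resolvent_set"
  shows "G \<mu> x y = resolvent \<mu> (unit y) x"
proof -
  have "(THE f. f \<in> wl2 \<and> Lop p \<mu> f = unit y) = resolvent \<mu> (unit y)"
    using assms
    by (intro the_equality) (auto simp: resolvent_in_wl2 Lop_resolvent wl2_indicator resolvent_eqI)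
  then show ?thesis
    by (simp add: green_def l2m_eq_wl2)
qed

lemma
  assumes "\<mu> \<in> resolvent_set"
  shows green_in_wl2: "(\<lambda>x. G \<mu> x y) \<in> wl2"
    and Lop_green: "Lop p \<mu> (\<lambda>x. G \<mu> x y) = unit y"
  using assms by (simp_all add: green_eq_resolvent resolvent_in_wl2 Lop_resolvent wl2_indicator)

lemma eq_green_cmult:
  assumes \<mu>: "\<mu> \<in> resolvent_set" and h: "h \<in> wl2" "\<And>x. Lop p \<mu> h x = (if x = y then a else 0)"
  shows "h x = a * G \<mu> x y"
proof -
  have "resolvent \<mu> (Lop p \<mu> h) = h"
    by (rule resolvent_eqI[OF \<mu> h(1) refl])
  moreover have "resolvent \<mu> (Lop p \<mu> h) = (\<lambda>x. a * G \<mu> x y)"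
    by (rule resolvent_eqI[OF \<mu>]) (auto simp: wl2_cmult green_in_wl2 Lop_cmult Lop_green \<mu> h(2))
  ultimately show ?thesis
    by (metis (mono_tags))
qed

lemma p_cut_branch:
  fixes u :: "'v \<Rightarrow> complex"
  assumes v: "v \<noteq> rt" and zero: "u (par v) = 0"
  shows "complex_of_real (p x y) * (if v \<in> anc y then 0 else u y)
    = (if v \<in> anc x then 0 else
        p x y * u y + (if y = v then if x = par v then - (p x v * u v) else 0 else 0))"
proof (cases "adj x y")
  case True
  have v_par: "v \<in> anc v" "v \<notin> anc (par v)"
    using self_in_anc not_anc_par[OF v] by auto
  consider (same_side) "v \<in> anc x \<longleftrightarrow> v \<in> anc y"
    | (entering) "v \<notin> anc x" "y = v" "x = par v"
    | (leaving) "v \<in> anc x" "v \<notin> anc y" "y = par v"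
    using adj_leaving_branch[OF True] adj_leaving_branch[OF adj_sym[OF True]] by blast
  then show ?thesis
  proof cases
    case same_side
    then have "\<not> (y = v \<and> x = par v)"
      using v_par by metis
    then show ?thesis
      using same_side by (simp split: if_splits)
  qed (use v_par zero in simp_all)
next
  case False
  then have "\<not> (y = v \<and> x = par v)"
    using kids_par[OF v] by (auto simp: adj_iff)
  then show ?thesis
    using False by (auto simp: p_eq_0)
qed

lemma Lop_cut_branch:
  fixes u :: "'v \<Rightarrow> complex"
  assumes u: "Pdefined p u" and v: "v \<noteq> rt" and zero: "u (par v) = 0"
  shows "Lop p \<mu> (\<lambda>x. if v \<in> anc x then 0 else u x) x
    = (if v \<in> anc x then 0 else Lop p \<mu> u x + (if x = par v then p x v * u v else 0))"
proof -
  let ?flow = "if x = par v then - (p x v * u v) else 0"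
  have "((\<lambda>y. if y = v then ?flow else 0) has_sum ?flow) UNIV"
    by (rule has_sum_finite_neutralI[of "{v}"]) auto
  then have "((\<lambda>y. p x y * u y + (if y = v then ?flow else 0)) has_sum (Pop p u x + ?flow)) UNIV"
    by (rule has_sum_add[OF has_sum_Pop[OF u]])
  then have "((\<lambda>y. complex_of_real (p x y) * (if v \<in> anc y then 0 else u y)) has_sum
      (if v \<in> anc x then 0 else Pop p u x + ?flow)) UNIV"
    unfolding p_cut_branch[where u = u, OF v zero]
    by (cases "v \<in> anc x") (simp_all only: if_True if_False has_sum_0_simp)
  then have "Pop p (\<lambda>y. if v \<in> anc y then 0 else u y) x
      = (if v \<in> anc x then 0 else Pop p u x + ?flow)"
    by (rule Pop_eqI)
  then show ?thesis
    by (simp add: Lop_def)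
qed

text \<open>Cutting \<open>u\<close> off along the edge from \<open>par v\<close> to \<open>v\<close> leaves a function \<open>h\<close> with \<open>(\<mu> - P) h\<close>
  supported at \<open>par v\<close>, that is, a multiple of \<open>G(\<cdot>, par v)\<close>; it vanishes at \<open>par v\<close>, hence
  everywhere.\<close>

lemma
  fixes u :: "'v \<Rightarrow> complex"
  assumes \<mu>: "\<mu> \<in> resolvent_set" and v: "v \<noteq> rt" and nz: "G \<mu> (par v) (par v) \<noteq> 0"
    and u: "u \<in> wl2" and zero: "u (par v) = 0"
    and harmonic: "\<And>x. v \<notin> anc x \<Longrightarrow> x \<noteq> par v \<Longrightarrow> Lop p \<mu> u x = 0"
  shows vanishes_outside_branch: "v \<notin> anc x \<Longrightarrow> u x = 0"
    and Lop_at_parent: "Lop p \<mu> u (par v) + p (par v) v * u v = 0"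
proof -
  let ?h = "\<lambda>x. if v \<in> anc x then 0 else u x" and ?a = "Lop p \<mu> u (par v) + p (par v) v * u v"
  have "?h \<in> wl2"
    by (rule wl2_cut[OF u])
  moreover have "Lop p \<mu> ?h x = (if x = par v then ?a else 0)" for x
    using harmonic[of x] not_anc_par[OF v] by (simp add: Lop_cut_branch Pdefined_wl2 u v zero)
  ultimately have cut_eq: "?h x = ?a * G \<mu> x (par v)" for x
    by (rule eq_green_cmult[OF \<mu>])
  have "?a * G \<mu> (par v) (par v) = 0"
    by (subst cut_eq[symmetric]) (simp add: zero)
  then show coefficient_zero: "?a = 0"
    using nz by simp
  show "u x = 0" if "v \<notin> anc x"
    using cut_eq[of x] that by (simp add: coefficient_zero)
qed

lemma green_through_parent:
  assumes \<mu>: "\<mu> \<in> resolvent_set"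
    and v: "v \<noteq> rt" and nz: "G \<mu> (par v) (par v) \<noteq> 0" and x: "v \<notin> anc x"
  shows "G \<mu> x v * G \<mu> (par v) (par v) = G \<mu> x (par v) * G \<mu> (par v) v"
proof -
  define u where "u x = G \<mu> (par v) (par v) * G \<mu> x v - G \<mu> (par v) v * G \<mu> x (par v)" for x
  have "u x = 0"
  proof (rule vanishes_outside_branch[OF \<mu> v nz _ _ _ x])
    show "u \<in> wl2"
      unfolding u_def by (intro wl2_diff wl2_cmult green_in_wl2 \<mu>)
    show "Lop p \<mu> u y = 0" if "v \<notin> anc y" "y \<noteq> par v" for y
    proof -
      have "Lop p \<mu> u y = G \<mu> (par v) (par v) * unit v y - G \<mu> (par v) v * unit (par v) y"
        unfolding u_def
        by (subst Lop_diff)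
          (auto simp: Lop_cmult Lop_green \<mu> intro!: Pdefined_wl2 wl2_cmult green_in_wl2)
      then show ?thesis
        using that self_in_anc[of y] by auto
    qed
  qed (simp add: u_def)
  then show ?thesis
    by (simp add: u_def mult.commute)
qed

lemma green_parent_nonzero:
  assumes \<mu>: "\<mu> \<in> resolvent_set" and v: "v \<noteq> rt" and nz: "\<And>x. G \<mu> x x \<noteq> 0"
  shows "G \<mu> (par v) v \<noteq> 0"
proof
  assume "G \<mu> (par v) v = 0"
  then have "Lop p \<mu> (\<lambda>x. G \<mu> x v) (par v) + p (par v) v * G \<mu> v v = 0"
    by (rule Lop_at_parent[OF \<mu> v nz green_in_wl2[OF \<mu>]])
      (use self_in_anc in \<open>auto simp: Lop_green \<mu>\<close>)
  moreover have "par v \<noteq> v" "p (par v) v \<noteq> 0"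
    using not_anc_par[OF v] self_in_anc[of v] p_pos_iff[of "par v" v] kids_par[OF v]
    by (auto simp: adj_iff)
  ultimately show False
    using nz by (simp add: Lop_green \<mu>)
qed

lemma green_root_nonzero:
  assumes \<mu>: "\<mu> \<in> resolvent_set" and nz: "\<And>x. G \<mu> x x \<noteq> 0"
  shows "G \<mu> rt v \<noteq> 0"
proof (induction v rule: tree_induct)
  case root
  then show ?case
    by (rule nz)
next
  case (child x y)
  then have y: "y \<noteq> rt" "par y = x" "y \<notin> anc rt"
    by (auto simp: children_def anc_root)
  have "G \<mu> rt y * G \<mu> x x = G \<mu> rt x * G \<mu> x y"
    using green_through_parent[OF \<mu> y(1) nz y(3)] y by simp
  moreover have "G \<mu> x y \<noteq> 0"
    using green_parent_nonzero[OF \<mu> y(1) nz] y by simp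
  ultimately show ?case
    using child nz by force
qed

definition green_fps :: "complex \<Rightarrow> 'v \<Rightarrow> 'v \<Rightarrow> complex fps" where
  "green_fps \<mu> x v = Abs_fps (\<lambda>k. (-1) ^ k * (resolvent \<mu> ^^ Suc k) (unit v) x)"

lemma has_fps_expansion_green:
  assumes \<mu>: "\<mu> \<in> resolvent_set"
  shows "(\<lambda>t. G (\<mu> + t) x v) has_fps_expansion green_fps \<mu> x v"
proof (rule has_fps_expansionI)
  show "eventually (\<lambda>t. (\<lambda>k. fps_nth (green_fps \<mu> x v) k * t ^ k) sums G (\<mu> + t) x v) (nhds 0)"
    using eventually_resolvent_set[OF \<mu>] resolvent_expansion[OF \<mu> wl2_indicator]
    by eventually_elim (simp add: green_fps_def green_eq_resolvent)
qed

lemma green_fps_nth_in_wl2: "(\<lambda>x. fps_nth (green_fps \<mu> x v) k) \<in> wl2"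
  by (simp add: green_fps_def wl2_cmult resolvent_in_wl2)

lemma Lop_green_fps:
  assumes \<mu>: "\<mu> \<in> resolvent_set"
  shows "Lop p \<mu> (\<lambda>x. fps_nth (green_fps \<mu> x v) k) x
    = (if k = 0 then unit v x else - fps_nth (green_fps \<mu> x v) (k - 1))"
proof -
  have "(resolvent \<mu> ^^ k) (unit v) \<in> wl2"
    by (cases k) (simp_all add: wl2_indicator resolvent_in_wl2)
  then have "Lop p \<mu> (\<lambda>x. fps_nth (green_fps \<mu> x v) k) x = (-1) ^ k * (resolvent \<mu> ^^ k) (unit v) x"
    by (simp add: green_fps_def Lop_cmult Lop_resolvent \<mu>)
  then show ?thesis
    by (cases k) (simp_all add: green_fps_def)
qed

lemma green_fps_nth_0: "\<mu> \<in> resolvent_set \<Longrightarrow> fps_nth (green_fps \<mu> x v) 0 = G \<mu> x v"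
  by (simp add: green_fps_def green_eq_resolvent)

lemma green_fps_through_parent:
  assumes \<mu>: "\<mu> \<in> resolvent_set"
    and v: "v \<noteq> rt" and nz: "G \<mu> (par v) (par v) \<noteq> 0" and x: "v \<notin> anc x"
  shows "green_fps \<mu> x v * green_fps \<mu> (par v) (par v)
      = green_fps \<mu> x (par v) * green_fps \<mu> (par v) v"
proof (rule fps_expansion_unique_complex)
  note expansions =
    has_fps_expansion_mult[OF has_fps_expansion_green[OF \<mu>] has_fps_expansion_green[OF \<mu>]]
  show "(\<lambda>t. G (\<mu> + t) x (par v) * G (\<mu> + t) (par v) v) has_fps_expansion
      green_fps \<mu> x (par v) * green_fps \<mu> (par v) v"
    by (rule expansions)
  have "continuous (at 0) (\<lambda>t. G (\<mu> + t) (par v) (par v))"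
    by (rule has_fps_expansion_imp_continuous[OF has_fps_expansion_green[OF \<mu>]])
  then have "eventually (\<lambda>t. G (\<mu> + t) (par v) (par v) \<noteq> 0) (nhds 0)"
    using nz by (intro tendsto_imp_eventually_ne) (simp_all add: isCont_def tendsto_nhds_iff)
  with eventually_resolvent_set[OF \<mu>]
  have "eventually (\<lambda>t. G (\<mu> + t) x v * G (\<mu> + t) (par v) (par v)
      = G (\<mu> + t) x (par v) * G (\<mu> + t) (par v) v) (nhds 0)"
    by eventually_elim (rule green_through_parent[OF _ v _ x])
  then show "(\<lambda>t. G (\<mu> + t) x (par v) * G (\<mu> + t) (par v) v) has_fps_expansion
      green_fps \<mu> x v * green_fps \<mu> (par v) (par v)"
    by (rule has_fps_expansion_cong[THEN iffD1, OF _ refl expansions])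
qed

end

locale resolvent_walk = tree_walk adj rt p + leafless_tree adj rt
  for adj :: "'v \<Rightarrow> 'v \<Rightarrow> bool" and rt p +
  fixes lam :: complex
  assumes lam: "lam \<in> resP_star adj p rt"
begin

definition charge :: "nat \<Rightarrow> 'v \<Rightarrow> complex" where
  "charge r v = fps_nth (inverse (green_fps lam rt v)) r"

definition kernel :: "nat \<Rightarrow> 'v \<Rightarrow> 'v \<Rightarrow> complex" where
  "kernel r v x = fps_nth (green_fps lam x v / green_fps lam rt v) r"

lemma lam_in_resolvent_set: "lam \<in> resolvent_set"
  using lam by (simp add: resP_star_def resP_eq_resolvent_set)

lemma green_diagonal_nonzero: "G lam x x \<noteq> 0"
  using lam by (simp add: resP_star_def)

lemma green_fps_root_unit: "fps_nth (green_fps lam rt v) 0 \<noteq> 0"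
  using green_root_nonzero[OF lam_in_resolvent_set green_diagonal_nonzero]
  by (simp add: green_fps_nth_0 lam_in_resolvent_set)

lemma kernel_eq_sum: "kernel r v = (\<lambda>x. \<Sum>i=0..r. charge (r - i) v * fps_nth (green_fps lam x v) i)"
  by (simp add: kernel_def charge_def fps_divide_unit green_fps_root_unit fps_mult_nth
      mult.commute fun_eq_iff)

lemma higher_deriv_kernel: "(deriv ^^ r) (\<lambda>\<mu>. G \<mu> x v / G \<mu> rt v) lam = fact r * kernel r v x"
proof -
  have "(\<lambda>t. G (lam + t) x v / G (lam + t) rt v)
      has_fps_expansion green_fps lam x v / green_fps lam rt v"
    by (intro has_fps_expansion_divide' has_fps_expansion_green lam_in_resolvent_set
        green_fps_root_unit)
  then show ?thesis
    using fps_nth_fps_expansion by (subst higher_deriv_shift_0) (simp add: kernel_def o_def)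
qed

lemma kernel_eq_kernel_parent:
  assumes v: "v \<noteq> rt" "v \<notin> anc x"
  shows "kernel r v x = kernel r (par v) x"
proof -
  let ?F = "green_fps lam"
  note through_parent = green_fps_through_parent[OF lam_in_resolvent_set v(1) green_diagonal_nonzero]
  have "?F x v * ?F (par v) (par v) = ?F x (par v) * ?F (par v) v"
    and "?F rt v * ?F (par v) (par v) = ?F rt (par v) * ?F (par v) v"
    using through_parent[of x] through_parent[of rt] v by (simp_all add: anc_root)
  then have "?F x v * ?F rt (par v) * ?F (par v) (par v)
      = ?F rt v * ?F x (par v) * ?F (par v) (par v)"
    by algebra
  moreover have "?F (par v) (par v) \<noteq> 0"
    using green_fps_nth_0[OF lam_in_resolvent_set, of "par v" "par v"] green_diagonal_nonzero
    by auto
  ultimately have "?F x v * ?F rt (par v) = ?F rt v * ?F x (par v)"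
    by simp
  moreover have "?F rt u \<noteq> 0" for u
    using green_fps_root_unit[of u] by auto
  ultimately have "?F x v / ?F rt v = ?F x (par v) / ?F rt (par v)"
    using dvd_div_div_eq_mult[OF _ _ fps_unit_dvd fps_unit_dvd] green_fps_root_unit by blast
  then show ?thesis
    by (simp add: kernel_def)
qed

lemma Pdefined_kernel_taylor: "Pdefined p (kernel r v)"
  unfolding kernel_eq_sum by (intro Pdefined_sum Pdefined_cmult Pdefined_wl2 green_fps_nth_in_wl2)

lemma Lop_kernel_taylor:
  "Lop p lam (kernel r v) x =
    (if x = v then charge r v else 0) - (if r = 0 then 0 else kernel (r - 1) v x)"
proof -
  have "Lop p lam (kernel r v) x
      = (\<Sum>i=0..r. Lop p lam (\<lambda>x. charge (r - i) v * fps_nth (green_fps lam x v) i) x)"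
    unfolding kernel_eq_sum by (intro Lop_sum Pdefined_cmult Pdefined_wl2 green_fps_nth_in_wl2)
  also have "\<dots> = (\<Sum>i=0..r. charge (r - i) v *
      (if i = 0 then unit v x else - fps_nth (green_fps lam x v) (i - 1)))"
    by (simp only: Lop_cmult Lop_green_fps[OF lam_in_resolvent_set])
  also have "\<dots> = (if x = v then charge r v else 0) - (if r = 0 then 0 else kernel (r - 1) v x)"
  proof (cases r)
    case (Suc n)
    then show ?thesis
      unfolding Suc sum.atLeast0_atMost_Suc_shift kernel_eq_sum by (simp add: sum_negf)
  qed simp
  finally show ?thesis .
qed

sublocale kernel_tree adj rt p lam kernel charge
proof
  show "p x y \<noteq> 0 \<longleftrightarrow> adj x y" for x y
    using p_pos_iff[of x y] p_eq_0[of x y] by auto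
  show "charge 0 v \<noteq> 0" "kernel 0 rt rt \<noteq> 0" for v
    using green_fps_root_unit by (simp_all add: charge_def kernel_def fps_divide_unit)
qed (simp_all add: kernel_eq_kernel_parent Pdefined_kernel_taylor Lop_kernel_taylor)

lemma Krep_eq_kernel_integral_sum:
  assumes "\<And>r. r < n \<Longrightarrow> cdist adj rt (\<nu> r)"
  shows "Krep adj p rt lam n \<nu> = kernel_integral_sum n (\<lambda>r x. fact r * \<nu> r x)"
proof
  fix x
  have "loc_integral adj rt (anc x) (Kderiv adj p rt r lam x) (\<nu> r)
      = kernel_integral r (\<lambda>x. fact r * \<nu> r x) x"
    if "r < n" for r
  proof -
    have "Kderiv adj p rt r lam x \<xi> = fact r * kernel r (confl adj rt x \<xi>) x" for \<xi>
      by (simp add: Kderiv_def Kern_def higher_deriv_kernel)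
    then have "loc_integral adj rt (anc x) (Kderiv adj p rt r lam x) (\<nu> r)
        = (\<Sum>v\<in>anc x. increment (\<lambda>v. fact r * kernel r v x) v * \<nu> r v)"
      by (rule loc_integral_confl[OF assms[OF that]])
    moreover have "increment (\<lambda>v. fact r * kernel r v x) v = fact r * kernel_incr r v x" for v
      by (simp add: kernel_incr_def increment_def right_diff_distrib)
    ultimately show ?thesis
      by (simp add: kernel_integral_def mult_ac)
  qed
  then show "Krep adj p rt lam n \<nu> x = kernel_integral_sum n (\<lambda>r x. fact r * \<nu> r x) x"
    by (simp add: Krep_def kernel_integral_sum_def)
qed

lemma polyharmonic_Krep:
  assumes "\<And>r. r < n \<Longrightarrow> cdist adj rt (\<nu> r)"
  shows "polyharmonic p lam n (Krep adj p rt lam n \<nu>)"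
proof -
  have "polyharmonic p lam n (kernel_integral_sum n (\<lambda>r x. fact r * \<nu> r x))"
    by (rule polyharmonic_kernel_integral_sum) (rule cdist_cmult[OF assms])
  then show ?thesis
    by (simp only: Krep_eq_kernel_integral_sum assms)
qed

lemma polyharmonic_imp_Krep:
  assumes "polyharmonic p lam n f"
  shows "\<exists>\<nu>. (\<forall>r<n. cdist adj rt (\<nu> r)) \<and> f = Krep adj p rt lam n \<nu>"
proof -
  obtain \<mu> where \<mu>: "\<forall>r<n. cdist adj rt (\<mu> r)" "f = kernel_integral_sum n \<mu>"
    using polyharmonic_imp_kernel_integral_sum[OF assms] by blast
  define \<nu> where "\<nu> r = (\<lambda>x. inverse (fact r) * \<mu> r x)" for r
  have \<nu>: "cdist adj rt (\<nu> r)" if "r < n" for r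
    unfolding \<nu>_def using \<mu>(1) that by (intro cdist_cmult[of adj rt "\<mu> r"]) simp
  have "Krep adj p rt lam n \<nu> = kernel_integral_sum n (\<lambda>r x. fact r * \<nu> r x)"
    by (rule Krep_eq_kernel_integral_sum) (rule \<nu>)
  also have "\<dots> = f"
    by (simp add: \<nu>_def \<mu>(2) flip: mult.assoc)
  finally show ?thesis
    using \<nu> by metis
qed

lemma Krep_inj:
  assumes \<nu>: "\<And>r. r < n \<Longrightarrow> cdist adj rt (\<nu> r)" and \<nu>': "\<And>r. r < n \<Longrightarrow> cdist adj rt (\<nu>' r)"
    and Krep_eq: "Krep adj p rt lam n \<nu> = Krep adj p rt lam n \<nu>'" and r: "r < n"
  shows "\<nu> r = \<nu>' r"
proof -
  have "kernel_integral_sum n (\<lambda>r x. fact r * \<nu> r x)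
      = kernel_integral_sum n (\<lambda>r x. fact r * \<nu>' r x)"
    using Krep_eq by (simp only: Krep_eq_kernel_integral_sum \<nu> \<nu>')
  then have "(\<lambda>x. fact r * \<nu> r x) = (\<lambda>x. fact r * \<nu>' r x)"
    using kernel_integral_sum_inj[of n "\<lambda>r x. fact r * \<nu> r x" "\<lambda>r x. fact r * \<nu>' r x" r]
      r cdist_cmult[OF \<nu>] cdist_cmult[OF \<nu>'] by blast
  then show ?thesis
    by (simp add: fun_eq_iff)
qed

end

theorem theorem5p3:
  fixes adj :: "'v::countable \<Rightarrow> 'v \<Rightarrow> bool"
    and p :: "'v \<Rightarrow> 'v \<Rightarrow> real"
    and rt :: 'v
    and lam :: complex
    and n :: nat
  assumes "is_tree adj" and "no_leaves adj"
    and "stochastic adj p"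
    and "lam \<in> resP_star adj p rt"
    and "n \<ge> 1"
  shows "(\<forall>f. polyharmonic p lam n f \<longrightarrow>
            (\<exists>\<nu>. (\<forall>r<n. cdist adj rt (\<nu> r)) \<and> (\<forall>x. f x = Krep adj p rt lam n \<nu> x)) \<and>
            (\<forall>\<nu> \<nu>'. (\<forall>r<n. cdist adj rt (\<nu> r)) \<and> (\<forall>x. f x = Krep adj p rt lam n \<nu> x) \<and>
                     (\<forall>r<n. cdist adj rt (\<nu>' r)) \<and> (\<forall>x. f x = Krep adj p rt lam n \<nu>' x)
                     \<longrightarrow> (\<forall>r<n. \<nu> r = \<nu>' r)))
       \<and> (\<forall>\<nu>. (\<forall>r<n. cdist adj rt (\<nu> r)) \<longrightarrow> polyharmonic p lam n (Krep adj p rt lam n \<nu>))"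
proof -
  interpret resolvent_walk adj rt p lam
    using assms by unfold_locales
  show ?thesis
  proof (intro conjI allI impI)
    show "\<exists>\<nu>. (\<forall>r<n. cdist adj rt (\<nu> r)) \<and> (\<forall>x. f x = Krep adj p rt lam n \<nu> x)"
      if "polyharmonic p lam n f" for f
      using polyharmonic_imp_Krep[OF that] by metis
    show "\<nu> r = \<nu>' r"
      if "(\<forall>r<n. cdist adj rt (\<nu> r)) \<and> (\<forall>x. f x = Krep adj p rt lam n \<nu> x) \<and>
          (\<forall>r<n. cdist adj rt (\<nu>' r)) \<and> (\<forall>x. f x = Krep adj p rt lam n \<nu>' x)" "r < n" for f \<nu> \<nu>' r
    proof (rule Krep_inj)
      show "Krep adj p rt lam n \<nu> = Krep adj p rt lam n \<nu>'"
        using that(1) by (metis ext)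
    qed (use that in auto)
    show "polyharmonic p lam n (Krep adj p rt lam n \<nu>)" if "\<forall>r<n. cdist adj rt (\<nu> r)" for \<nu>
      using that by (simp add: polyharmonic_Krep)
  qed
qed

end
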